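(* Let $\mathsf H$, $T$, $V$, $L$, $F=T+V$, the stochastic oracle, the RISFBF process and the restricted gap function $\mathrm{Gap}(\cdot\mid\mathsf C)$ be as in the context. Assume $\{x:0\in F(x)\}\ne\emptyset$; $\mathbb E_\xi[\hat V(x,\xi)]=V(x)$ and $\mathbb E_\xi[\|\hat V(x,\xi)-V(x)\|^2]\le\sigma^2$ for some $\sigma>0$ and all $x\in\mathsf H$. Let $a>1$, $m_k=\lfloor k^a\rfloor$ and $\lambda_k=\lambda\in(0,1/(2L))$ for every $k\in\mathbb N$. Suppose $(\alpha_k)_{k\in\mathbb N}$ is a non-decreasing sequence with $0<\alpha_k\le\bar\alpha<1$ and $\rho_k=\frac{3(1-\bar\alpha)^2}{2(2\alpha_k^2-\alpha_k+1)(1+L\lambda)}$ for every $k\in\mathbb N$. Let $$\bar X_K=\frac{\sum_{k=1}^K\rho_kY_k}{\sum_{k=1}^K\rho_k}.$$ Then: (i) $\mathbb E[\mathrm{Gap}(\bar X_K\mid\mathsf C)]\le\mathcal O(1/K)$ for every $K\in\mathbb N$, $K\ge1$ (i.e. bounded above by a constant independent of $K$ times $1/K$). (ii) Given $\varepsilon>0$, let $K_\varepsilon=\inf\{k\in\mathbb N:\mathbb E[\mathrm{Gap}(\bar X_k\mid\mathsf C)]\le\varepsilon\}$. Then $\sum_{k=1}^{K_\varepsilon}m_k\le\mathcal O\left(1/\varepsilon^{1+a}\right)$ (as $\varepsilon\downarrow0$).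
   Context: $\mathsf H$ is a real separable Hilbert space with inner product $\langle\cdot,\cdot\rangle$ and norm $\|\cdot\|$. $T:\mathsf H\to2^{\mathsf H}$ is maximally monotone; $V:\mathsf H\to\mathsf H$ is maximally monotone and $L$-Lipschitz continuous ($L>0$) with full domain. $F=T+V$ and $J_{\lambda T}=(\mathrm{Id}+\lambda T)^{-1}$ is the resolvent. Restricted gap: for an arbitrary reference point $x^s\in\operatorname{dom}T$ and a constant $D>0$, $\mathsf C=\operatorname{dom}T\cap\{x\in\mathsf H:\|x-x^s\|\le D\}$ (taken to be closed), and $\mathrm{Gap}(x\mid\mathsf C)=\sup\{\langle y^*,x-y\rangle:y\in\mathsf C,\ y^*\in F(y)\}$. Oracle: on a complete probability space $(\Omega,\mathcal F,\mathbb P)$, $\xi$ is a random variable with values in a measurable set $\Xi\subseteq\mathbb R^d$ and law $\mathsf P$; $\hat V:\mathsf H\times\Xi\to\mathsf H$ is a (measurable) random operator estimating $V$. RISFBF algorithm: given initial points $X_0,X_1\in\operatorname{dom}T$, nonnegative sequences $(\alpha_k)$, $(\rho_k)$, step sizes $\lambda_k>0$ and batch sizes $m_k\in\mathbb N$, $m_k\geq 1$, for $k\ge1$: $Z_k=X_k+\alpha_k(X_k-X_{k-1})$; $Y_k=J_{\lambda_kT}(Z_k-\lambda_kA_k)$ with $A_k=\frac1{m_k}\sum_{t=1}^{m_k}\hat V(Z_k,\xi_k^{(t)})$; $X_{k+1}=(1-\rho_k)Z_k+\rho_k[Y_k+\lambda_k(A_k-B_k)]$ with $B_k=\frac1{m_k}\sum_{t=1}^{m_k}\hat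 V(Y_k,\eta_k^{(t)})$; where all samples $\xi_k^{(t)},\eta_k^{(t)}$ ($1\le t\le m_k$, $k\ge1$) are independent draws from $\mathsf P$, independent of the past. *)

theory Defs
  imports "HOL-Probability.Probability" "HOL-Library.Landau_Symbols"
begin

text \<open>Set-valued operators on a space \<open>'h\<close> are functions \<^typ>\<open>'h \<Rightarrow> 'h set\<close>; a single-valued
  operator \<open>V\<close> is identified with \<open>\<lambda>x. {V x}\<close>.\<close>

definition op_dom :: "('h \<Rightarrow> 'h set) \<Rightarrow> 'h set" where
  "op_dom T = {x. T x \<noteq> {}}"

definition op_add :: "('h::plus \<Rightarrow> 'h set) \<Rightarrow> ('h \<Rightarrow> 'h set) \<Rightarrow> 'h \<Rightarrow> 'h set" where
  "op_add S T = (\<lambda>x. {u + v | u v. u \<in> S x \<and> v \<in> T x})"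

definition op_scale :: "real \<Rightarrow> ('h::real_vector \<Rightarrow> 'h set) \<Rightarrow> 'h \<Rightarrow> 'h set" where
  "op_scale c T = (\<lambda>x. {c *\<^sub>R u | u. u \<in> T x})"

definition op_inverse :: "('h \<Rightarrow> 'h set) \<Rightarrow> 'h \<Rightarrow> 'h set" where
  "op_inverse T = (\<lambda>u. {x. u \<in> T x})"

definition op_single :: "('h \<Rightarrow> 'h) \<Rightarrow> 'h \<Rightarrow> 'h set" where
  "op_single f = (\<lambda>x. {f x})"

definition monotone_op :: "('h::real_inner \<Rightarrow> 'h set) \<Rightarrow> bool" where
  "monotone_op T \<longleftrightarrow> (\<forall>x y. \<forall>u\<in>T x. \<forall>v\<in>T y. 0 \<le> inner (u - v) (x - y))"

definition maximal_monotone_op :: "('h::real_inner \<Rightarrow> 'h set) \<Rightarrow> bool" where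
  "maximal_monotone_op T \<longleftrightarrow>
     monotone_op T \<and> (\<forall>S. monotone_op S \<and> (\<forall>x. T x \<subseteq> S x) \<longrightarrow> S = T)"

text \<open>The resolvent \<open>(Id + c T)\<^sup>-\<^sup>1\<close> as the inverse of a set-valued operator. For \<open>c > 0\<close> and
  maximally monotone \<open>T\<close> on a Hilbert space its values are singletons (Minty), so that
  membership in a value is the same as equality with the single-valued resolvent.\<close>

definition resolvent :: "real \<Rightarrow> ('h::real_vector \<Rightarrow> 'h set) \<Rightarrow> 'h \<Rightarrow> 'h set" where
  "resolvent c T = op_inverse (op_add (op_single id) (op_scale c T))"

definition restricted_set :: "('h::real_normed_vector \<Rightarrow> 'h set) \<Rightarrow> 'h \<Rightarrow> real \<Rightarrow> 'h set" where
  "restricted_set T xs D = op_dom T \<inter> {x. norm (x - xs) \<le> D}"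

definition gap :: "('h::real_inner \<Rightarrow> 'h set) \<Rightarrow> 'h set \<Rightarrow> 'h \<Rightarrow> ereal" where
  "gap F C x = Sup {ereal (inner u (x - y)) | y u. y \<in> C \<and> u \<in> F y}"

text \<open>Expectation of an extended real random variable, as the expectation of the positive part
  minus that of the negative part (\<^const>\<open>e2ennreal\<close> truncates negative values to \<open>0\<close>). In
  \<^typ>\<open>ereal\<close> one has \<open>\<infinity> - \<infinity> = \<infinity>\<close>, so a finite upper bound entails that the positive part has
  finite expectation.\<close>

definition ereal_expectation :: "'w measure \<Rightarrow> ('w \<Rightarrow> ereal) \<Rightarrow> ereal" where
  "ereal_expectation M f =
     enn2ereal (\<integral>\<^sup>+\<omega>. e2ennreal (f \<omega>) \<partial>M) - enn2ereal (\<integral>\<^sup>+\<omega>. e2ennreal (- f \<omega>) \<partial>M)"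

text \<open>The samples \<open>xi k t\<close> and \<open>eta k t\<close> with \<open>k \<ge> 1\<close>, \<open>1 \<le> t \<le> m k\<close> form one jointly independent
  family of draws from \<open>P\<close>, a probability measure on the sample space.\<close>

definition independent_draws ::
  "'w measure \<Rightarrow> 'z measure \<Rightarrow> (nat \<Rightarrow> nat) \<Rightarrow> (nat \<Rightarrow> nat \<Rightarrow> 'w \<Rightarrow> 'z) \<Rightarrow>
   (nat \<Rightarrow> nat \<Rightarrow> 'w \<Rightarrow> 'z) \<Rightarrow> bool" where
  "independent_draws M P m xi eta \<longleftrightarrow>
     (let I = {(k, t). 1 \<le> k \<and> 1 \<le> t \<and> t \<le> m k} in
       prob_space.indep_vars M (\<lambda>_. P)
         (case_sum (\<lambda>(k, t). xi k t) (\<lambda>(k, t). eta k t)) (I <+> I) \<and>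
       (\<forall>(k, t)\<in>I. distr M P (xi k t) = P \<and> distr M P (eta k t) = P))"

definition batch_mean :: "('h \<Rightarrow> 'z \<Rightarrow> 'h::real_vector) \<Rightarrow> nat \<Rightarrow> 'h \<Rightarrow> (nat \<Rightarrow> 'z) \<Rightarrow> 'h" where
  "batch_mean Vhat n x z = (1 / real n) *\<^sub>R (\<Sum>t=1..n. Vhat x (z t))"

text \<open>\<open>X\<close> and \<open>Y\<close> are the iterates produced on the sample space \<open>\<Omega>\<close> from the deterministic initial
  points \<open>x0\<close>, \<open>x1\<close>. The values of \<open>Y\<close> and of all parameter sequences at index \<open>0\<close> are irrelevant.\<close>

definition risfbf_process ::
  "'w set \<Rightarrow> ('h::real_vector \<Rightarrow> 'h set) \<Rightarrow> ('h \<Rightarrow> 'z \<Rightarrow> 'h) \<Rightarrow>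
   (nat \<Rightarrow> real) \<Rightarrow> (nat \<Rightarrow> real) \<Rightarrow> (nat \<Rightarrow> real) \<Rightarrow> (nat \<Rightarrow> nat) \<Rightarrow>
   (nat \<Rightarrow> nat \<Rightarrow> 'w \<Rightarrow> 'z) \<Rightarrow> (nat \<Rightarrow> nat \<Rightarrow> 'w \<Rightarrow> 'z) \<Rightarrow>
   'h \<Rightarrow> 'h \<Rightarrow> (nat \<Rightarrow> 'w \<Rightarrow> 'h) \<Rightarrow> (nat \<Rightarrow> 'w \<Rightarrow> 'h) \<Rightarrow> bool" where
  "risfbf_process \<Omega> T Vhat \<alpha> \<rho> lam m xi eta x0 x1 X Y \<longleftrightarrow>
     (\<forall>\<omega>\<in>\<Omega>. X 0 \<omega> = x0 \<and> X 1 \<omega> = x1 \<and>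
       (\<forall>k\<ge>1.
         let Z = X k \<omega> + \<alpha> k *\<^sub>R (X k \<omega> - X (k - 1) \<omega>);
             A = batch_mean Vhat (m k) Z (\<lambda>t. xi k t \<omega>);
             B = batch_mean Vhat (m k) (Y k \<omega>) (\<lambda>t. eta k t \<omega>)
         in Y k \<omega> \<in> resolvent (lam k) T (Z - lam k *\<^sub>R A) \<and>
            X (k + 1) \<omega> = (1 - \<rho> k) *\<^sub>R Z + \<rho> k *\<^sub>R (Y k \<omega> + lam k *\<^sub>R (A - B))))"

definition ergodic_average ::
  "(nat \<Rightarrow> real) \<Rightarrow> (nat \<Rightarrow> 'w \<Rightarrow> 'h::real_vector) \<Rightarrow> nat \<Rightarrow> 'w \<Rightarrow> 'h" where
  "ergodic_average \<rho> Y K \<omega> = (\<Sum>k=1..K. \<rho> k *\<^sub>R Y k \<omega>) /\<^sub>R (\<Sum>k=1..K. \<rho> k)"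

text \<open>The first index \<open>k \<ge> 1\<close> at which \<open>e k \<le> \<epsilon>\<close>. The infimum of the empty set of naturals is \<open>0\<close>
  rather than \<open>\<infinity>\<close>, so this is meaningful only when such an index exists, as is the case for every
  \<open>\<epsilon> > 0\<close> when \<open>e k \<le> c / k\<close> for all \<open>k \<ge> 1\<close>.\<close>

definition first_index_le :: "(nat \<Rightarrow> ereal) \<Rightarrow> real \<Rightarrow> nat" where
  "first_index_le e \<epsilon> = Inf {k. 1 \<le> k \<and> e k \<le> ereal \<epsilon>}"

end

theory Submission imports Defs begin

text \<open>For \<open>p\<close> in the restricted set, one step of the method decreases the Lyapunov function
  \<open>\<parallel>X k - p\<parallel>\<^sup>2 - \<alpha> k * \<parallel>X (k - 1) - p\<parallel>\<^sup>2 + w k * \<parallel>X k - X (k - 1)\<parallel>\<^sup>2 \<ge> 0\<close> by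
  \<open>2 * lam * \<rho> k * \<langle>u, Y k - p\<rangle>\<close>, for \<open>u \<in> F p\<close>, up to squared batch noise and the term
  \<open>\<langle>UB k, Y k - p\<rangle>\<close>, where \<open>UB k\<close> is the noise of the second batch. Splitting \<open>Y k - p\<close> at the
  reference point \<open>xs\<close>, the part \<open>\<langle>UB k, Y k - xs\<rangle>\<close> has mean zero, and the sum of the
  parts \<open>\<rho> k * \<langle>UB k, xs - p\<rangle>\<close> is at most \<open>D\<close> times the norm of a martingale, uniformly in \<open>p\<close>.
  The variances are of order \<open>1 / m k\<close>, which is summable as \<open>a > 1\<close>. So the expected supremum over
  \<open>p\<close> of the weighted sums stays bounded, and dividing by the sum of the \<open>\<rho> k\<close>, which grows linearly
  in \<open>K\<close>, gives the rate. Hence \<open>K\<^sub>\<epsilon>\<close> is of order \<open>1 / \<epsilon>\<close>, and the batch sizes sum up to at most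
  \<open>K\<^sub>\<epsilon> powr (1 + a)\<close>.\<close>

subsection \<open>The deterministic energy estimate\<close>

lemma mem_resolvent_iff: "y \<in> resolvent c T x \<longleftrightarrow> (\<exists>u\<in>T y. x = y + c *\<^sub>R u)"
  by (auto simp: resolvent_def op_inverse_def op_add_def op_single_def op_scale_def)

text \<open>The update is the relaxed step \<open>Xn = Z - \<rho> *\<^sub>R (e - g)\<close>, whose
  direction \<open>e - g = lam *\<^sub>R (u + B)\<close> is, up to noise, \<open>lam\<close> times
  an element of \<open>F Yk\<close>. Monotonicity of \<open>T\<close> and \<open>V\<close> bounds
  its product with \<open>Yk - p\<close> from below, and the Lipschitz condition keeps the
  correction \<open>g\<close> small against \<open>e\<close>.\<close>

lemma forward_backward_forward_step:
  fixes Z Yk A B p v :: "'h::real_inner" and V :: "'h \<Rightarrow> 'h"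
  assumes T: "monotone_op T"
    and V: "monotone_op (op_single V)" "L-lipschitz_on UNIV V"
    and L: "0 < L" and lam: "0 < lam" "2 * L * lam < 1" and \<rho>: "0 < \<rho>"
    and Y: "Yk \<in> resolvent lam T (Z - lam *\<^sub>R A)"
    and v: "v \<in> T p"
    and X: "Xn = (1 - \<rho>) *\<^sub>R Z + \<rho> *\<^sub>R (Yk + lam *\<^sub>R (A - B))"
  shows "(norm (Xn - p))\<^sup>2 \<le> (norm (Z - p))\<^sup>2
     - (3 / (2 * (1 + L * lam)) / \<rho> - 1) * (norm (Xn - Z))\<^sup>2
     + (6 * \<rho> * lam\<^sup>2 * ((norm (A - V Z))\<^sup>2 + (norm (B - V Yk))\<^sup>2)
        - 2 * lam * \<rho> * inner (B - V Yk) (Yk - p) - 2 * lam * \<rho> * inner (v + V p) (Yk - p))"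
proof -
  define s where "s = L * lam"
  have s: "0 < s" "2 * s < 1" using L lam by (auto simp: s_def)
  define c where "c = 3 / (2 * (1 + s))"
  obtain u where u: "u \<in> T Yk" "Z - lam *\<^sub>R A = Yk + lam *\<^sub>R u"
    using Y unfolding mem_resolvent_iff by blast
  define e where "e = Z - Yk"
  define f where "f = Yk - p"
  define g where "g = lam *\<^sub>R (A - B)"
  define d where "d = (norm (e - g))\<^sup>2"
  define UA where "UA = A - V Z"
  define UB where "UB = B - V Yk"
  have eg: "e - g = lam *\<^sub>R (u + B)"
    using u(2) by (simp add: e_def g_def algebra_simps)
  have "inner (u - v) f \<ge> 0" using T u v unfolding monotone_op_def f_def by blast
  moreover have "inner (V Yk - V p) f \<ge> 0"
    using V(1) unfolding monotone_op_def f_def op_single_def by blast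
  ultimately have "inner (u + B) f \<ge> inner (v + V p) f + inner UB f"
    by (simp add: UB_def inner_simps)
  from mult_left_mono[OF this, of lam] lam(1)
  have 1: "inner (e - g) f \<ge> lam * inner (v + V p) f + lam * inner UB f"
    by (simp add: eg distrib_left)
  define w where "w = norm (UA - UB)"
  have "norm (A - B) = norm ((V Z - V Yk) + (UA - UB))" by (simp add: UA_def UB_def)
  also have "\<dots> \<le> norm (V Z - V Yk) + w" unfolding w_def by (rule norm_triangle_ineq)
  also have "norm (V Z - V Yk) \<le> L * norm e"
    using lipschitz_onD[OF V(2), of Z Yk] by (simp add: dist_norm e_def)
  finally have "norm (A - B) \<le> L * norm e + w" by simp
  from mult_left_mono[OF this, of lam] lam(1)
  moreover have "norm g = lam * norm (A - B)" using lam(1) by (simp add: g_def)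
  ultimately have g: "norm g \<le> s * norm e + lam * w"
    by (simp add: s_def algebra_simps)
  have sq: "(x + y)\<^sup>2 \<le> 2 * x\<^sup>2 + 2 * y\<^sup>2" for x y :: real
    by (smt (verit) power2_sum sum_squares_bound)
  have g2: "(norm g)\<^sup>2 \<le> 2 * s\<^sup>2 * (norm e)\<^sup>2 + 2 * lam\<^sup>2 * w\<^sup>2"
    using power_mono[OF g, of 2] sq[of "s * norm e" "lam * w"] by (simp add: power_mult_distrib)
  have "norm (e - g) \<le> (1 + s) * norm e + lam * w"
    using norm_triangle_ineq4[of e g] g by (simp add: algebra_simps)
  then have d2: "d \<le> 2 * (1 + s)\<^sup>2 * (norm e)\<^sup>2 + 2 * lam\<^sup>2 * w\<^sup>2"
    using power_mono[of "norm (e - g)" "(1 + s) * norm e + lam * w" 2]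
      sq[of "(1 + s) * norm e" "lam * w"] by (simp add: power_mult_distrib d_def)
  have w2: "w\<^sup>2 \<le> 2 * ((norm UA)\<^sup>2 + (norm UB)\<^sup>2)"
    using power_mono[OF norm_triangle_ineq4[of UA UB] norm_ge_zero, of 2] sq[of "norm UA" "norm UB"]
    unfolding w_def distrib_left by (rule order_trans)
  have c1: "c - 1 = (1 - 2 * s) / (2 * (1 + s))" using s by (simp add: c_def field_simps)
  have c0: "0 \<le> c - 1" using s by (simp add: c1)
  have chalf: "c - 1 \<le> 1 / 2" using s by (simp add: c1 field_simps)
  \<comment> \<open>The value of \<open>c\<close> is chosen for this cancellation: the coefficient
    of \<open>(norm e)\<^sup>2\<close> collapses to \<open>- s\<close>. The restriction
    \<open>2 * s < 1\<close> makes \<open>c - 1\<close> nonnegative, so that the bound on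
    \<open>d\<close> may be multiplied by it.\<close>
  have "(c - 1) * (2 * (1 + s)\<^sup>2) = (1 - 2 * s) * (1 + s)"
    using s by (simp add: c1 field_simps power2_eq_square)
  then have c2: "(c - 1) * (2 * (1 + s)\<^sup>2) + 2 * s\<^sup>2 - 1 \<le> 0"
    using s by (simp add: algebra_simps power2_eq_square)
  have "(c - 1) * d + (norm g)\<^sup>2 - (norm e)\<^sup>2
      \<le> (c - 1) * (2 * (1 + s)\<^sup>2 * (norm e)\<^sup>2 + 2 * lam\<^sup>2 * w\<^sup>2) + (2 * s\<^sup>2 * (norm e)\<^sup>2 + 2 * lam\<^sup>2 * w\<^sup>2) - (norm e)\<^sup>2"
    using mult_left_mono[OF d2 c0] g2 by linarith
  also have "\<dots> = ((c - 1) * (2 * (1 + s)\<^sup>2) + 2 * s\<^sup>2 - 1) * (norm e)\<^sup>2 + (c - 1) * (2 * lam\<^sup>2 * w\<^sup>2) + 2 * lam\<^sup>2 * w\<^sup>2"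
    by (simp add: algebra_simps)
  also have "\<dots> \<le> 0 + 1 / 2 * (2 * lam\<^sup>2 * w\<^sup>2) + 2 * lam\<^sup>2 * w\<^sup>2"
    using c2 chalf by (intro add_mono mult_right_mono mult_nonpos_nonneg) auto
  also have "\<dots> = 3 * lam\<^sup>2 * w\<^sup>2" by simp
  also have "\<dots> \<le> 6 * lam\<^sup>2 * ((norm UA)\<^sup>2 + (norm UB)\<^sup>2)"
    using mult_left_mono[OF w2, of "3 * lam\<^sup>2"] by (simp add: algebra_simps)
  finally have 2: "(c - 1) * d + (norm g)\<^sup>2 - (norm e)\<^sup>2 \<le> 6 * lam\<^sup>2 * ((norm UA)\<^sup>2 + (norm UB)\<^sup>2)" .
  have XZ: "Xn - Z = - (\<rho> *\<^sub>R (e - g))" by (simp add: X e_def g_def algebra_simps)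
  have XZ2: "(norm (Xn - Z))\<^sup>2 = \<rho>\<^sup>2 * d" by (simp add: XZ d_def power_mult_distrib)
  have Xp: "Xn - p = (Z - p) - \<rho> *\<^sub>R (e - g)" using XZ by (simp add: algebra_simps)
  have cr: "(c / \<rho> - 1) * (\<rho>\<^sup>2 * d) = c * \<rho> * d - \<rho>\<^sup>2 * d"
    using \<rho> by (simp add: left_diff_distrib power2_eq_square)
  have sqn: "(norm (x - \<rho> *\<^sub>R y))\<^sup>2 = (norm x)\<^sup>2 - 2 * \<rho> * inner y x + \<rho>\<^sup>2 * (norm y)\<^sup>2" for x y :: 'h
    unfolding power2_norm_eq_inner
    by (simp add: inner_diff_left inner_diff_right inner_commute[of x y] power2_eq_square algebra_simps)
  \<comment> \<open>Since \<open>Z - p = e + f\<close>, this is the polarization identity for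
    \<open>inner (e - g) e\<close>.\<close>
  have ip: "2 * inner (e - g) (Z - p) = d + (norm e)\<^sup>2 - (norm g)\<^sup>2 + 2 * inner (e - g) f"
    by (simp add: d_def e_def f_def power2_norm_eq_inner inner_diff_left inner_diff_right inner_commute)
  have "(norm (Xn - p))\<^sup>2 = (norm (Z - p))\<^sup>2 - \<rho> * (2 * inner (e - g) (Z - p)) + \<rho>\<^sup>2 * d"
    unfolding Xp d_def sqn by simp
  \<comment> \<open>Adding and subtracting \<open>c * \<rho> * d\<close> isolates the multiple of
    \<open>(norm (Xn - Z))\<^sup>2\<close> that later pays for the inertia; the remaining bracket is
    controlled by facts \<open>1\<close> and \<open>2\<close>.\<close>
  then have 3: "(norm (Xn - p))\<^sup>2 = (norm (Z - p))\<^sup>2 - (c / \<rho> - 1) * (\<rho>\<^sup>2 * d)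
      + \<rho> * (((c - 1) * d + (norm g)\<^sup>2 - (norm e)\<^sup>2) - 2 * inner (e - g) f)"
    unfolding ip cr by (simp add: algebra_simps)
  have "\<rho> * (((c - 1) * d + (norm g)\<^sup>2 - (norm e)\<^sup>2) - 2 * inner (e - g) f)
      \<le> \<rho> * (6 * lam\<^sup>2 * ((norm UA)\<^sup>2 + (norm UB)\<^sup>2)
           - 2 * (lam * inner (v + V p) f + lam * inner UB f))"
    using 1 2 \<rho> by (intro mult_left_mono) auto
  then show ?thesis
    unfolding 3 XZ2 c_def[unfolded s_def, symmetric]
    by (simp add: UA_def UB_def f_def algebra_simps)
qed

text \<open>With \<open>\<rho>\<close> as in the theorem, the weight is the coefficient \<open>3 / (2 * (1 + L * lam)) / \<rho> - 1\<close> of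
  the previous lemma.\<close>

definition inertia_weight :: "real \<Rightarrow> real \<Rightarrow> real" where
  "inertia_weight b \<alpha> = (2 * \<alpha>\<^sup>2 - \<alpha> + 1) / (1 - b)\<^sup>2 - 1"

text \<open>Here \<open>x'\<close> is the iterate before \<open>x\<close>. The factor
  \<open>1 - \<alpha>\<close> is the share of the squared increment that survives when the distance
  to the extrapolated point is expanded in \<open>energy_step\<close>.\<close>

definition energy :: "real \<Rightarrow> real \<Rightarrow> 'h::real_inner \<Rightarrow> 'h \<Rightarrow> 'h \<Rightarrow> real" where
  "energy b \<alpha> p x x' = (norm (x - p))\<^sup>2 - \<alpha> * (norm (x' - p))\<^sup>2
      + (1 - \<alpha>) * inertia_weight b \<alpha> * (norm (x - x'))\<^sup>2"

text \<open>The numerator \<open>2 * \<alpha>\<^sup>2 - \<alpha> + 1\<close> equals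
  \<open>(1 - \<alpha>)\<^sup>2 + \<alpha> * (1 + \<alpha>)\<close>, so equality holds at
  \<open>\<alpha> = b\<close>; for smaller \<open>\<alpha>\<close> the ratio of
  \<open>(1 - \<alpha>)\<^sup>2\<close> to \<open>(1 - b)\<^sup>2\<close> is at least 1, which only
  helps.\<close>

lemma inertia_weight_ge:
  assumes "0 < \<alpha>" "\<alpha> \<le> b" "b < 1"
  shows "inertia_weight b \<alpha> * (1 - \<alpha>)\<^sup>2 \<ge> \<alpha> * (1 + \<alpha>)"
proof -
  have q: "2 * \<alpha>\<^sup>2 - \<alpha> + 1 > 0" using assms
    by (smt (verit) zero_le_power2)
  have "(1 - b)\<^sup>2 \<le> (1 - \<alpha>)\<^sup>2" using assms by (intro power_mono) auto
  then have "(2 * \<alpha>\<^sup>2 - \<alpha> + 1) * 1 \<le> (2 * \<alpha>\<^sup>2 - \<alpha> + 1) * ((1 - \<alpha>)\<^sup>2 / (1 - b)\<^sup>2)"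
    using q assms by (intro mult_left_mono) auto
  then show ?thesis
    unfolding inertia_weight_def by (simp add: algebra_simps power2_eq_square)
qed

lemma inertia_weight_nonneg:
  assumes "0 < \<alpha>" "\<alpha> \<le> b" "b < 1"
  shows "inertia_weight b \<alpha> \<ge> 0"
proof -
  have "inertia_weight b \<alpha> * (1 - \<alpha>)\<^sup>2 \<ge> 0"
    using inertia_weight_ge[OF assms] assms by (smt (verit) mult_nonneg_nonneg)
  then show ?thesis using assms by (simp add: zero_le_mult_iff)
qed

text \<open>This lets the energy switch from one inertia parameter to the next larger one. After
  clearing the denominator, the difference of the two cubics \<open>g\<close> has the factor
  \<open>\<beta> - \<alpha>\<close>, and the cofactor \<open>Q\<close> is bounded below by a
  quadratic in \<open>u = \<alpha> + \<beta>\<close> alone.\<close>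

lemma inertia_weight_antimono:
  assumes "0 < \<alpha>" "\<alpha> \<le> \<beta>" "\<beta> \<le> b" "b < 1"
  shows "(1 - \<beta>) * inertia_weight b \<beta> \<le> (1 - \<alpha>) * inertia_weight b \<alpha>"
proof -
  define g where "g x = (1 - x) * (2 * x\<^sup>2 - x + 1 - (1 - b)\<^sup>2)" for x
  have g: "(1 - x) * inertia_weight b x = g x / (1 - b)\<^sup>2" for x
    using assms by (simp add: g_def inertia_weight_def field_simps)
  define Q where "Q = 2 * (\<alpha>\<^sup>2 + \<alpha> * \<beta> + \<beta>\<^sup>2) - 3 * (\<alpha> + \<beta>) + 1 + (2 * b - b\<^sup>2)"
  have eq: "g \<alpha> - g \<beta> = (\<beta> - \<alpha>) * Q"
    by (simp add: g_def Q_def algebra_simps power2_eq_square)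
  define u where "u = \<alpha> + \<beta>"
  have u: "0 < u" "u \<le> 2 * b" using assms by (auto simp: u_def)
  have "2 * (\<alpha>\<^sup>2 + \<alpha> * \<beta> + \<beta>\<^sup>2) = 3 / 2 * u\<^sup>2 + (\<alpha> - \<beta>)\<^sup>2 / 2"
    by (simp add: u_def field_simps power2_eq_square)
  then have Q: "Q \<ge> 3 / 2 * u\<^sup>2 - 3 * u + 1 + (2 * b - b\<^sup>2)"
    by (simp add: Q_def u_def)
  \<comment> \<open>The quadratic has its vertex at \<open>u = 1\<close>. For
    \<open>b \<le> 1 / 2\<close> the range \<open>u \<le> 2 * b\<close> stays to the left of it, so
    the minimum is at \<open>u = 2 * b\<close>; otherwise already the value at the vertex is
    positive.\<close>
  have "Q \<ge> 0"
  proof (cases "b \<le> 1 / 2")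
    case True
    have "3 / 2 * u\<^sup>2 - 3 * u + 1 + (2 * b - b\<^sup>2)
        = (2 * b - u) * (3 - 3 / 2 * (2 * b + u)) + (5 * (b - 2 / 5)\<^sup>2 + 1 / 5)"
      by (simp add: field_simps power2_eq_square)
    moreover have "(2 * b - u) * (3 - 3 / 2 * (2 * b + u)) \<ge> 0"
      using u True by (intro mult_nonneg_nonneg) auto
    ultimately show ?thesis using Q by (smt (verit) zero_le_power2 divide_nonneg_nonneg)
  next
    case False
    have "3 / 2 * u\<^sup>2 - 3 * u + 1 + (2 * b - b\<^sup>2) = 3 / 2 * (u - 1)\<^sup>2 + ((1 - b) * (b - 1 / 2) + (b / 2))"
      by (simp add: field_simps power2_eq_square)
    moreover have "(1 - b) * (b - 1 / 2) \<ge> 0" using False assms by simp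
    ultimately show ?thesis using Q assms
      by (smt (verit) zero_le_power2 divide_nonneg_nonneg mult_nonneg_nonneg)
  qed
  then have "g \<beta> \<le> g \<alpha>" using eq assms by (smt (verit) mult_nonneg_nonneg)
  then show ?thesis unfolding g by (simp add: divide_right_mono)
qed

text \<open>Completing the square: with weight \<open>\<alpha> / (1 - \<alpha>)\<close> on the
  increment, the expression is the squared norm of \<open>(1 - \<alpha>) *\<^sub>R (x - p) +
  \<alpha> *\<^sub>R (x - x')\<close> divided by \<open>1 - \<alpha>\<close>. The actual weight is
  at least as large.\<close>

lemma energy_nonneg:
  assumes "0 < \<alpha>" "\<alpha> \<le> b" "b < 1"
  shows "energy b \<alpha> p x x' \<ge> 0"
proof -
  define f where "f = x - p"
  define g where "g = x - x'"
  have w: "(1 - \<alpha>) * inertia_weight b \<alpha> \<ge> \<alpha> / (1 - \<alpha>)"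
  proof -
    have "\<alpha> * 1 \<le> \<alpha> * (1 + \<alpha>)" using assms by (intro mult_left_mono) auto
    then have "\<alpha> \<le> inertia_weight b \<alpha> * (1 - \<alpha>)\<^sup>2"
      using inertia_weight_ge[OF assms] by simp
    then show ?thesis using assms by (simp add: field_simps power2_eq_square)
  qed
  have "0 \<le> (norm ((1 - \<alpha>) *\<^sub>R f + \<alpha> *\<^sub>R g))\<^sup>2 / (1 - \<alpha>)" using assms by simp
  also have "\<dots> = ((1 - \<alpha>)\<^sup>2 * (norm f)\<^sup>2 + 2 * \<alpha> * (1 - \<alpha>) * inner f g + \<alpha>\<^sup>2 * (norm g)\<^sup>2) / (1 - \<alpha>)"
    unfolding power2_norm_eq_inner
    by (simp add: inner_add_left inner_add_right inner_commute[of g f] power2_eq_square)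
      (simp add: algebra_simps)
  also have "\<dots> = (norm f)\<^sup>2 - \<alpha> * ((norm f)\<^sup>2 - 2 * inner f g + (norm g)\<^sup>2) + \<alpha> / (1 - \<alpha>) * (norm g)\<^sup>2"
    using assms by (simp add: field_simps power2_eq_square)
  also have "(norm f)\<^sup>2 - 2 * inner f g + (norm g)\<^sup>2 = (norm (x' - p))\<^sup>2"
  proof -
    have "x' - p = f - g" by (simp add: f_def g_def)
    then show ?thesis by (simp add: power2_norm_eq_inner inner_simps inner_commute)
  qed
  also have "\<alpha> / (1 - \<alpha>) * (norm g)\<^sup>2 \<le> (1 - \<alpha>) * inertia_weight b \<alpha> * (norm g)\<^sup>2"
    using w by (intro mult_right_mono) auto
  finally show ?thesis by (simp add: energy_def f_def g_def)
qed

text \<open>Both distances from \<open>z\<close> are expanded into the increments \<open>g\<close>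
  and \<open>h\<close>. The lower bound on the inertia weight is exactly what absorbs the positive
  multiples of \<open>(norm g)\<^sup>2\<close>, and monotonicity in the parameter then turns
  \<open>\<alpha>\<close> into \<open>\<beta>\<close>.\<close>

lemma energy_step:
  fixes p :: "'h::real_inner"
  assumes \<alpha>: "0 < \<alpha>" "\<alpha> \<le> \<beta>" "\<beta> \<le> b" "b < 1"
    and z: "z = x + \<alpha> *\<^sub>R (x - x')"
    and step: "(norm (x'' - p))\<^sup>2 \<le> (norm (z - p))\<^sup>2 - inertia_weight b \<alpha> * (norm (x'' - z))\<^sup>2 + N"
  shows "energy b \<beta> p x'' x \<le> energy b \<alpha> p x x' + N"
proof -
  define f where "f = x - p"
  define g where "g = x - x'"
  define h where "h = x'' - x"
  define w where "w = inertia_weight b \<alpha>"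
  have w0: "0 \<le> w" unfolding w_def using inertia_weight_nonneg[of \<alpha> b] \<alpha> by simp
  have zp: "(norm (z - p))\<^sup>2 = (1 + \<alpha>) * (norm f)\<^sup>2 - \<alpha> * (norm (x' - p))\<^sup>2 + \<alpha> * (1 + \<alpha>) * (norm g)\<^sup>2"
  proof -
    have 1: "z - p = f + \<alpha> *\<^sub>R g" "x' - p = f - g" by (simp_all add: f_def g_def z)
    show ?thesis unfolding 1
      by (simp add: power2_norm_eq_inner inner_simps inner_commute algebra_simps)
  qed
  have "(norm (x'' - z))\<^sup>2 = (norm (h - \<alpha> *\<^sub>R g))\<^sup>2" by (simp add: h_def g_def z algebra_simps)
  also have "\<dots> = (1 - \<alpha>) * (norm h)\<^sup>2 - \<alpha> * (1 - \<alpha>) * (norm g)\<^sup>2 + \<alpha> * (norm (h - g))\<^sup>2"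
    by (simp add: power2_norm_eq_inner inner_simps inner_commute algebra_simps)
  \<comment> \<open>Only the square of \<open>h - \<alpha> *\<^sub>R g\<close> is split, as a
    convex-combination identity; its nonnegative term in \<open>h - g\<close> is dropped.\<close>
  finally have xz: "(norm (x'' - z))\<^sup>2 \<ge> (1 - \<alpha>) * (norm h)\<^sup>2 - \<alpha> * (1 - \<alpha>) * (norm g)\<^sup>2"
    using \<alpha> by simp
  have "(norm (x'' - p))\<^sup>2 + w * ((1 - \<alpha>) * (norm h)\<^sup>2)
      \<le> (1 + \<alpha>) * (norm f)\<^sup>2 - \<alpha> * (norm (x' - p))\<^sup>2 + (\<alpha> * (1 + \<alpha>) + w * (\<alpha> * (1 - \<alpha>))) * (norm g)\<^sup>2 + N"
    using step mult_left_mono[OF xz w0] unfolding zp w_def[symmetric] by (simp add: algebra_simps)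
  also have "\<alpha> * (1 + \<alpha>) + w * (\<alpha> * (1 - \<alpha>)) \<le> (1 - \<alpha>) * w"
  proof -
    have "w * (1 - \<alpha>)\<^sup>2 + w * (\<alpha> * (1 - \<alpha>)) = (1 - \<alpha>) * w"
      by (simp add: algebra_simps power2_eq_square)
    then show ?thesis using inertia_weight_ge[of \<alpha> b] \<alpha> unfolding w_def by simp
  qed
  finally have "(norm (x'' - p))\<^sup>2 + w * ((1 - \<alpha>) * (norm h)\<^sup>2)
      \<le> (1 + \<alpha>) * (norm f)\<^sup>2 - \<alpha> * (norm (x' - p))\<^sup>2 + (1 - \<alpha>) * w * (norm g)\<^sup>2 + N"
    by (simp add: mult_right_mono)
  moreover have "(1 - \<beta>) * inertia_weight b \<beta> * (norm h)\<^sup>2 \<le> (1 - \<alpha>) * w * (norm h)\<^sup>2"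
    unfolding w_def using inertia_weight_antimono[of \<alpha> \<beta> b] \<alpha> by (intro mult_right_mono) auto
  moreover have "\<alpha> * (norm f)\<^sup>2 \<le> \<beta> * (norm f)\<^sup>2" using \<alpha> by (intro mult_right_mono) auto
  ultimately show ?thesis
    by (simp add: energy_def f_def g_def h_def w_def algebra_simps)
qed

text \<open>Since the resolvent is nonexpansive on its domain, it extends continuously to the closure of
  the domain. Thus measurability of the iterates does not need Minty's theorem.\<close>

lemma resolvent_measurable_selection:
  fixes T :: "'h::{real_inner, banach, second_countable_topology} \<Rightarrow> 'h set"
  assumes T: "monotone_op T" and lam: "0 < lam"
  obtains J where "J \<in> borel_measurable borel"
    and "\<And>x y. y \<in> resolvent lam T x \<Longrightarrow> y = J x"
    and "\<And>x y x' y'. y \<in> resolvent lam T x \<Longrightarrow> y' \<in> resolvent lam T x' \<Longrightarrow> norm (y - y') \<le> norm (x - x')"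
proof -
  have nonexp: "norm (y - y') \<le> norm (x - x')"
    if y: "y \<in> resolvent lam T x" "y' \<in> resolvent lam T x'" for x y x' y'
  proof -
    obtain u u' where u: "u \<in> T y" "x = y + lam *\<^sub>R u" "u' \<in> T y'" "x' = y' + lam *\<^sub>R u'"
      using y unfolding mem_resolvent_iff by blast
    have "0 \<le> lam * inner (u - u') (y - y')" using T u lam unfolding monotone_op_def by simp
    then have "(norm (y - y'))\<^sup>2 \<le> inner (x - x') (y - y')"
      by (simp add: u power2_norm_eq_inner inner_simps algebra_simps)
    also have "\<dots> \<le> norm (x - x') * norm (y - y')" by (rule norm_cauchy_schwarz)
    finally show ?thesis
      by (smt (verit, best) mult_right_le_imp_le norm_ge_zero power2_eq_square zero_less_norm_iff)
  qed
  define S where "S = {x. resolvent lam T x \<noteq> {}}"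
  define j where "j x = (SOME y. y \<in> resolvent lam T x)" for x
  have j: "j x \<in> resolvent lam T x" if "x \<in> S" for x
    using that unfolding S_def j_def by (simp add: some_in_eq)
  have "1-lipschitz_on S j"
    using nonexp[OF j j] by (auto simp: lipschitz_on_def dist_norm)
  from lipschitz_extend_closure[OF this] obtain g
    where g: "1-lipschitz_on (closure S) g" "\<And>x. x \<in> S \<Longrightarrow> g x = j x" by metis
  show thesis
  proof
    \<comment> \<open>The extension \<open>g\<close> is controlled only on the closed set
      \<open>closure S\<close>; cutting it off to 0 outside gives a Borel function on the whole
      space.\<close>
    show "(\<lambda>x. indicator (closure S) x *\<^sub>R g x) \<in> borel_measurable borel"
      using lipschitz_on_continuous_on[OF g(1)]
      by (intro borel_measurable_continuous_on_indicator) auto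
    fix x y assume y: "y \<in> resolvent lam T x"
    then have x: "x \<in> S" by (auto simp: S_def)
    then have "y = j x" using nonexp[OF y j[OF x]] by simp
    then show "y = indicator (closure S) x *\<^sub>R g x"
      using x g(2) closure_subset[of S] by (auto simp: indicator_def)
  qed (rule nonexp)
qed

text \<open>The positive part of \<open>f\<close> is at most that of \<open>G\<close>, and the
  negative part is at least that of \<open>G\<close>. \<open>nn_integral\<close> is monotone for
  arbitrary functions, so this applies to the gap, a supremum over a possibly uncountable set.
  Integrability of \<open>G\<close> excludes the form
  \<open>\<infinity> - \<infinity>\<close>.\<close>

lemma ereal_expectation_le_integral:
  assumes "integrable M G" and "\<And>\<omega>. \<omega> \<in> space M \<Longrightarrow> f \<omega> \<le> ereal (G \<omega>)"
  shows "ereal_expectation M f \<le> ereal (\<integral>\<omega>. G \<omega> \<partial>M)"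
proof -
  have eq: "(\<integral>\<^sup>+\<omega>. ennreal (h \<omega>) \<partial>M) = ennreal (\<integral>\<omega>. max 0 (h \<omega>) \<partial>M)"
    if "integrable M h" for h :: "'a \<Rightarrow> real"
  proof -
    have "(\<integral>\<^sup>+\<omega>. ennreal (h \<omega>) \<partial>M) = (\<integral>\<^sup>+\<omega>. ennreal (max 0 (h \<omega>)) \<partial>M)"
      by (rule nn_integral_cong) (simp add: max_def ennreal_neg)
    also have "\<dots> = ennreal (\<integral>\<omega>. max 0 (h \<omega>) \<partial>M)"
      using that by (intro nn_integral_eq_integral integrable_max) auto
    finally show ?thesis .
  qed
  have "(\<integral>\<^sup>+\<omega>. e2ennreal (f \<omega>) \<partial>M) \<le> (\<integral>\<^sup>+\<omega>. ennreal (G \<omega>) \<partial>M)"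
    using assms(2) by (intro nn_integral_mono) (metis e2ennreal_mono e2ennreal_ereal)
  then have 1: "enn2ereal (\<integral>\<^sup>+\<omega>. e2ennreal (f \<omega>) \<partial>M) \<le> ereal (\<integral>\<omega>. max 0 (G \<omega>) \<partial>M)"
    using eq[OF assms(1)] by (simp add: less_eq_ennreal.rep_eq)
  have "(\<integral>\<^sup>+\<omega>. ennreal (- G \<omega>) \<partial>M) \<le> (\<integral>\<^sup>+\<omega>. e2ennreal (- f \<omega>) \<partial>M)"
    using assms(2) by (intro nn_integral_mono)
      (metis e2ennreal_mono e2ennreal_ereal ereal_minus_le_minus uminus_ereal.simps(1))
  then have 2: "ereal (\<integral>\<omega>. max 0 (- G \<omega>) \<partial>M) \<le> enn2ereal (\<integral>\<^sup>+\<omega>. e2ennreal (- f \<omega>) \<partial>M)"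
    using eq[of "\<lambda>x. - G x"] assms(1) by (simp add: less_eq_ennreal.rep_eq)
  have "ereal_expectation M f \<le> ereal (\<integral>\<omega>. max 0 (G \<omega>) \<partial>M) - ereal (\<integral>\<omega>. max 0 (- G \<omega>) \<partial>M)"
    unfolding ereal_expectation_def using 1 2 by (rule ereal_minus_mono)
  also have "\<dots> = ereal (\<integral>\<omega>. max 0 (G \<omega>) - max 0 (- G \<omega>) \<partial>M)"
    using assms(1) by (subst Bochner_Integration.integral_diff) auto
  also have "(\<lambda>\<omega>. max 0 (G \<omega>) - max 0 (- G \<omega>)) = G" by auto
  finally show ?thesis .
qed

subsection \<open>Square integrability and noise of a stochastic oracle\<close>

definition square_integrable :: "'w measure \<Rightarrow> ('w \<Rightarrow> 'h::{real_inner, banach, second_countable_topology}) \<Rightarrow> bool" where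
  "square_integrable M f \<longleftrightarrow> f \<in> borel_measurable M \<and> integrable M (\<lambda>\<omega>. (norm (f \<omega>))\<^sup>2)"

lemma norm_add_squared_le: "(norm (x + y :: 'h::real_normed_vector))\<^sup>2 \<le> 2 * (norm x)\<^sup>2 + 2 * (norm y)\<^sup>2"
proof -
  have "(norm (x + y))\<^sup>2 \<le> (norm x + norm y)\<^sup>2"
    by (intro power_mono norm_triangle_ineq) auto
  also have "\<dots> \<le> 2 * (norm x)\<^sup>2 + 2 * (norm y)\<^sup>2"
    by (smt (verit) power2_sum sum_squares_bound)
  finally show ?thesis .
qed

lemma square_integrable_bound:
  assumes "square_integrable M f" "g \<in> borel_measurable M"
    and "\<And>\<omega>. \<omega> \<in> space M \<Longrightarrow> norm (g \<omega>) \<le> norm (f \<omega>)"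
  shows "square_integrable M g"
  unfolding square_integrable_def
proof
  have [measurable]: "g \<in> borel_measurable M" by (rule assms)
  have "integrable M (\<lambda>\<omega>. (norm (f \<omega>))\<^sup>2)" using assms(1) by (simp add: square_integrable_def)
  then show "integrable M (\<lambda>\<omega>. (norm (g \<omega>))\<^sup>2)"
  proof (rule Bochner_Integration.integrable_bound)
    show "AE \<omega> in M. norm ((norm (g \<omega>))\<^sup>2) \<le> norm ((norm (f \<omega>))\<^sup>2)"
      using power_mono[OF assms(3) norm_ge_zero, of _ 2] by (intro AE_I2) simp
  qed measurable
qed (rule assms)

lemma square_integrable_add:
  assumes "square_integrable M f" "square_integrable M g"
  shows "square_integrable M (\<lambda>\<omega>. f \<omega> + g \<omega>)"
  unfolding square_integrable_def
proof
  have [measurable]: "f \<in> borel_measurable M" "g \<in> borel_measurable M"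
    using assms by (auto simp: square_integrable_def)
  show "(\<lambda>\<omega>. f \<omega> + g \<omega>) \<in> borel_measurable M" by measurable
  have "integrable M (\<lambda>\<omega>. 2 * (norm (f \<omega>))\<^sup>2 + 2 * (norm (g \<omega>))\<^sup>2)"
    using assms by (simp add: square_integrable_def)
  then show "integrable M (\<lambda>\<omega>. (norm (f \<omega> + g \<omega>))\<^sup>2)"
  proof (rule Bochner_Integration.integrable_bound)
    show "AE \<omega> in M. norm ((norm (f \<omega> + g \<omega>))\<^sup>2) \<le> norm (2 * (norm (f \<omega>))\<^sup>2 + 2 * (norm (g \<omega>))\<^sup>2)"
      using norm_add_squared_le[of "f _" "g _"] by (intro AE_I2) simp
  qed measurable
qed

lemma square_integrable_scaleR:
  assumes "square_integrable M f"
  shows "square_integrable M (\<lambda>\<omega>. c *\<^sub>R f \<omega>)"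
  using assms by (auto simp: square_integrable_def power_mult_distrib)

lemma square_integrable_diff:
  assumes "square_integrable M f" "square_integrable M g"
  shows "square_integrable M (\<lambda>\<omega>. f \<omega> - g \<omega>)"
  using square_integrable_add[OF assms(1) square_integrable_scaleR[OF assms(2), of "-1"]] by simp

lemma square_integrable_norm:
  assumes "square_integrable M f"
  shows "square_integrable M (\<lambda>\<omega>. norm (f \<omega>))"
  using assms by (auto simp: square_integrable_def)

lemma (in prob_space) square_integrable_const: "square_integrable M (\<lambda>\<omega>. c)"
  by (auto simp: square_integrable_def)

lemma (in prob_space) square_integrable_sum:
  assumes "\<And>i. i \<in> I \<Longrightarrow> square_integrable M (f i)"
  shows "square_integrable M (\<lambda>\<omega>. \<Sum>i\<in>I. f i \<omega>)"
  using assms by (induction I rule: infinite_finite_induct)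
    (auto intro: square_integrable_add square_integrable_const)

lemma integrable_inner:
  assumes "square_integrable M f" "square_integrable M g"
  shows "integrable M (\<lambda>\<omega>. inner (f \<omega>) (g \<omega>))"
proof (rule Bochner_Integration.integrable_bound[of M "\<lambda>\<omega>. (norm (f \<omega>))\<^sup>2 + (norm (g \<omega>))\<^sup>2"])
  show "AE \<omega> in M. norm (inner (f \<omega>) (g \<omega>)) \<le> norm ((norm (f \<omega>))\<^sup>2 + (norm (g \<omega>))\<^sup>2)"
  proof (intro AE_I2)
    fix \<omega>
    have "\<bar>inner (f \<omega>) (g \<omega>)\<bar> \<le> norm (f \<omega>) * norm (g \<omega>)" by (rule Cauchy_Schwarz_ineq2)
    also have "\<dots> \<le> (norm (f \<omega>))\<^sup>2 + (norm (g \<omega>))\<^sup>2"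
      using sum_squares_bound[of "norm (f \<omega>)" "norm (g \<omega>)"]
        mult_nonneg_nonneg[OF norm_ge_zero[of "f \<omega>"] norm_ge_zero[of "g \<omega>"]] by linarith
    finally show "norm (inner (f \<omega>) (g \<omega>)) \<le> norm ((norm (f \<omega>))\<^sup>2 + (norm (g \<omega>))\<^sup>2)" by simp
  qed
qed (use assms in \<open>auto simp: square_integrable_def\<close>)

text \<open>Pythagoras in the space of square integrable vectors. Orthogonality is asked in the
  ordered form \<open>j < i\<close>, which is how it arises when later noise is fresh relative to
  earlier noise.\<close>

lemma integral_norm_sum_squared_orthogonal:
  fixes n :: nat
  assumes f: "\<And>i. i \<le> n \<Longrightarrow> square_integrable M (f i)"
    and orth: "\<And>i j. j < i \<Longrightarrow> i \<le> n \<Longrightarrow> 1 \<le> j \<Longrightarrow> (\<integral>\<omega>. inner (f i \<omega>) (f j \<omega>) \<partial>M) = 0"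
    and M: "prob_space M"
  shows "(\<integral>\<omega>. (norm (\<Sum>i=1..n. f i \<omega>))\<^sup>2 \<partial>M) = (\<Sum>i=1..n. \<integral>\<omega>. (norm (f i \<omega>))\<^sup>2 \<partial>M)"
  using f orth
proof (induction n)
  case (Suc n)
  interpret prob_space M by fact
  let ?S = "\<lambda>\<omega>. \<Sum>i=1..n. f i \<omega>"
  have S: "square_integrable M ?S" using Suc.prems(1) by (intro square_integrable_sum) auto
  have fn: "square_integrable M (f (Suc n))" using Suc.prems(1) by simp
  have "(\<integral>\<omega>. inner (f (Suc n) \<omega>) (?S \<omega>) \<partial>M) = (\<Sum>j=1..n. \<integral>\<omega>. inner (f (Suc n) \<omega>) (f j \<omega>) \<partial>M)"
    unfolding inner_sum_right using Suc.prems(1)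
    by (intro Bochner_Integration.integral_sum integrable_inner) auto
  also have "\<dots> = 0" using Suc.prems(2) by (intro sum.neutral) auto
  finally have 0: "(\<integral>\<omega>. inner (f (Suc n) \<omega>) (?S \<omega>) \<partial>M) = 0" .
  have "(\<integral>\<omega>. (norm (\<Sum>i=1..Suc n. f i \<omega>))\<^sup>2 \<partial>M)
      = (\<integral>\<omega>. (norm (?S \<omega>))\<^sup>2 + (norm (f (Suc n) \<omega>))\<^sup>2 + 2 * inner (f (Suc n) \<omega>) (?S \<omega>) \<partial>M)"
    by (intro Bochner_Integration.integral_cong)
      (auto simp: power2_norm_eq_inner inner_add_left inner_add_right inner_commute)
  also have "\<dots> = (\<integral>\<omega>. (norm (?S \<omega>))\<^sup>2 \<partial>M) + (\<integral>\<omega>. (norm (f (Suc n) \<omega>))\<^sup>2 \<partial>M)"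
    using S fn integrable_inner[OF fn S] 0
    by (subst Bochner_Integration.integral_add) (auto simp: square_integrable_def)
  finally show ?case using Suc by simp
qed simp

section \<open>Noise of the oracle at random query points\<close>

locale stochastic_oracle = prob_space M + P: prob_space P
  for M :: "'w measure" and P :: "'z measure" +
  fixes Vhat :: "'h::{real_inner, banach, second_countable_topology} \<Rightarrow> 'z \<Rightarrow> 'h"
    and V :: "'h \<Rightarrow> 'h" and \<sigma> :: real
  assumes Vhat_measurable[measurable]: "(\<lambda>(x, z). Vhat x z) \<in> borel \<Otimes>\<^sub>M P \<rightarrow>\<^sub>M borel"
    and V_measurable[measurable]: "V \<in> borel_measurable borel"
    and unbiased: "\<And>x. has_bochner_integral P (Vhat x) (V x)"
    and variance: "\<And>x. (\<integral>\<^sup>+z. ennreal ((norm (Vhat x z - V x))\<^sup>2) \<partial>P) \<le> ennreal (\<sigma>\<^sup>2)"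
begin

text \<open>A sigma-algebra is represented by a measure on it; only its measurable sets matter.\<close>

definition fresh :: "'w measure \<Rightarrow> ('w \<Rightarrow> 'z) \<Rightarrow> bool" where
  "fresh G \<zeta> \<longleftrightarrow> subalgebra M G \<and> \<zeta> \<in> M \<rightarrow>\<^sub>M P \<and>
     (\<forall>A\<in>sets G. \<forall>B\<in>sets P. prob (A \<inter> \<zeta> -` B) = prob A * measure P B)"

lemma fresh_measurable:
  assumes "fresh G \<zeta>"
  shows "(\<lambda>\<omega>. \<omega>) \<in> M \<rightarrow>\<^sub>M G" "\<zeta> \<in> M \<rightarrow>\<^sub>M P"
  using assms measurable_from_subalg[of M G "\<lambda>\<omega>. \<omega>" G] unfolding fresh_def by auto

lemma fresh_lift:
  assumes "fresh G \<zeta>" "f \<in> G \<rightarrow>\<^sub>M N"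
  shows "f \<in> M \<rightarrow>\<^sub>M N"
  using assms measurable_from_subalg unfolding fresh_def by blast

text \<open>Freshness is agreement of the two measures on rectangles, which determines a product of
  sigma-finite measures. With this, conditioning on \<open>G\<close> becomes Fubini: the sample is
  integrated out first, with everything measurable in \<open>G\<close> held fixed.\<close>

lemma fresh_distr:
  assumes "fresh G \<zeta>"
  shows "distr M G (\<lambda>\<omega>. \<omega>) \<Otimes>\<^sub>M P = distr M (G \<Otimes>\<^sub>M P) (\<lambda>\<omega>. (\<omega>, \<zeta> \<omega>))"
proof (rule pair_measure_eqI)
  note [measurable] = fresh_measurable[OF assms]
  interpret D: prob_space "distr M G (\<lambda>\<omega>. \<omega>)" by (intro prob_space_distr) simp
  show "sigma_finite_measure (distr M G (\<lambda>\<omega>. \<omega>))" "sigma_finite_measure P" by unfold_locales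
  show "sets (distr M G (\<lambda>\<omega>. \<omega>) \<Otimes>\<^sub>M P) = sets (distr M (G \<Otimes>\<^sub>M P) (\<lambda>\<omega>. (\<omega>, \<zeta> \<omega>)))" by simp
  fix A B assume "A \<in> sets (distr M G (\<lambda>\<omega>. \<omega>))" and B: "B \<in> sets P"
  then have A: "A \<in> sets G" by simp
  then have AM: "A \<subseteq> space M" "A \<in> sets M"
    using assms sets.sets_into_space[OF A] unfolding fresh_def subalgebra_def by auto
  have "prob (A \<inter> \<zeta> -` B) = prob A * measure P B" using assms A B unfolding fresh_def by blast
  moreover have "(\<lambda>\<omega>. (\<omega>, \<zeta> \<omega>)) -` (A \<times> B) \<inter> space M = A \<inter> \<zeta> -` B"
    "(\<lambda>\<omega>. \<omega>) -` A \<inter> space M = A" using AM by auto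
  ultimately show "emeasure (distr M G (\<lambda>\<omega>. \<omega>)) A * emeasure P B
      = emeasure (distr M (G \<Otimes>\<^sub>M P) (\<lambda>\<omega>. (\<omega>, \<zeta> \<omega>))) (A \<times> B)"
    using A B by (simp add: emeasure_distr emeasure_eq_measure P.emeasure_eq_measure ennreal_mult)
qed

lemma sample_nn_integral:
  assumes "fresh G \<zeta>" and g[measurable]: "g \<in> borel_measurable (G \<Otimes>\<^sub>M P)"
  shows "(\<integral>\<^sup>+\<omega>. g (\<omega>, \<zeta> \<omega>) \<partial>M) = (\<integral>\<^sup>+\<omega>. \<integral>\<^sup>+z. g (\<omega>, z) \<partial>P \<partial>M)"
proof -
  note [measurable] = fresh_measurable[OF assms(1)]
  have g': "g \<in> borel_measurable (distr M G (\<lambda>\<omega>. \<omega>) \<Otimes>\<^sub>M P)" by simp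
  have "(\<integral>\<^sup>+\<omega>. g (\<omega>, \<zeta> \<omega>) \<partial>M) = integral\<^sup>N (distr M (G \<Otimes>\<^sub>M P) (\<lambda>\<omega>. (\<omega>, \<zeta> \<omega>))) g"
    by (subst nn_integral_distr) auto
  also have "\<dots> = (\<integral>\<^sup>+\<omega>. \<integral>\<^sup>+z. g (\<omega>, z) \<partial>P \<partial>distr M G (\<lambda>\<omega>. \<omega>))"
    unfolding fresh_distr[OF assms(1), symmetric] using g' by (rule P.nn_integral_fst[symmetric])
  also have "\<dots> = (\<integral>\<^sup>+\<omega>. \<integral>\<^sup>+z. g (\<omega>, z) \<partial>P \<partial>M)"
    by (subst nn_integral_distr) auto
  finally show ?thesis .
qed

lemma sample_integral:
  fixes g :: "'w \<times> 'z \<Rightarrow> real"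
  assumes "fresh G \<zeta>" and g[measurable]: "g \<in> borel_measurable (G \<Otimes>\<^sub>M P)"
    and int: "integrable M (\<lambda>\<omega>. g (\<omega>, \<zeta> \<omega>))"
  shows "(\<integral>\<omega>. g (\<omega>, \<zeta> \<omega>) \<partial>M) = (\<integral>\<omega>. \<integral>z. g (\<omega>, z) \<partial>P \<partial>M)"
proof -
  note [measurable] = fresh_measurable[OF assms(1)]
  interpret D: prob_space "distr M G (\<lambda>\<omega>. \<omega>)" by (intro prob_space_distr) simp
  interpret DP: pair_prob_space "distr M G (\<lambda>\<omega>. \<omega>)" P ..
  have int': "integrable (distr M (G \<Otimes>\<^sub>M P) (\<lambda>\<omega>. (\<omega>, \<zeta> \<omega>))) g"
    using int by (subst integrable_distr_eq) auto
  have "(\<integral>\<omega>. g (\<omega>, \<zeta> \<omega>) \<partial>M) = integral\<^sup>L (distr M (G \<Otimes>\<^sub>M P) (\<lambda>\<omega>. (\<omega>, \<zeta> \<omega>))) g"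
    by (subst integral_distr) auto
  also have "\<dots> = (\<integral>\<omega>. \<integral>z. g (\<omega>, z) \<partial>P \<partial>distr M G (\<lambda>\<omega>. \<omega>))"
    using int' unfolding fresh_distr[OF assms(1), symmetric] by (rule DP.integral_fst'[symmetric])
  also have "\<dots> = (\<integral>\<omega>. \<integral>z. g (\<omega>, z) \<partial>P \<partial>M)"
    by (subst integral_distr) auto
  finally show ?thesis .
qed

definition noise :: "('w \<Rightarrow> 'h) \<Rightarrow> ('w \<Rightarrow> 'z) \<Rightarrow> 'w \<Rightarrow> 'h" where
  "noise y \<zeta> \<omega> = Vhat (y \<omega>) (\<zeta> \<omega>) - V (y \<omega>)"

text \<open>The variance bound is given for deterministic points only. It carries over to the random
  point \<open>y\<close> because the fresh sample can be integrated first for each fixed value of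
  \<open>y\<close>.\<close>

lemma noise_square_integrable:
  assumes "fresh G \<zeta>" and y[measurable]: "y \<in> borel_measurable G"
  shows "square_integrable M (noise y \<zeta>)" "(\<integral>\<omega>. (norm (noise y \<zeta> \<omega>))\<^sup>2 \<partial>M) \<le> \<sigma>\<^sup>2"
proof -
  note [measurable] = fresh_measurable[OF assms(1)] fresh_lift[OF assms(1) y]
  have meas[measurable]: "noise y \<zeta> \<in> borel_measurable M" unfolding noise_def by simp
  have "(\<integral>\<^sup>+\<omega>. ennreal ((norm (noise y \<zeta> \<omega>))\<^sup>2) \<partial>M)
      = (\<integral>\<^sup>+\<omega>. \<integral>\<^sup>+z. ennreal ((norm (Vhat (y \<omega>) z - V (y \<omega>)))\<^sup>2) \<partial>P \<partial>M)"
    using sample_nn_integral[OF assms(1), of "\<lambda>(\<omega>, z). ennreal ((norm (Vhat (y \<omega>) z - V (y \<omega>)))\<^sup>2)"]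
    unfolding noise_def by simp
  also have "\<dots> \<le> (\<integral>\<^sup>+\<omega>. ennreal (\<sigma>\<^sup>2) \<partial>M)" by (intro nn_integral_mono variance)
  also have "\<dots> = ennreal (\<sigma>\<^sup>2)" by (simp add: emeasure_space_1)
  finally have le: "(\<integral>\<^sup>+\<omega>. ennreal ((norm (noise y \<zeta> \<omega>))\<^sup>2) \<partial>M) \<le> ennreal (\<sigma>\<^sup>2)" .
  then have int: "integrable M (\<lambda>\<omega>. (norm (noise y \<zeta> \<omega>))\<^sup>2)"
    by (intro integrableI_bounded) (auto intro: le_less_trans)
  then show "square_integrable M (noise y \<zeta>)" by (simp add: square_integrable_def meas)
  show "(\<integral>\<omega>. (norm (noise y \<zeta> \<omega>))\<^sup>2 \<partial>M) \<le> \<sigma>\<^sup>2"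
    using le by (simp add: nn_integral_eq_integral[OF int])
qed

text \<open>For fixed \<open>\<omega>\<close> both \<open>y \<omega>\<close> and
  \<open>w \<omega>\<close> are constants, so the inner integral over the sample vanishes by
  unbiasedness.\<close>

lemma noise_orthogonal:
  assumes "fresh G \<zeta>" and y[measurable]: "y \<in> borel_measurable G"
    and w[measurable]: "w \<in> borel_measurable G" and w2: "square_integrable M w"
  shows "(\<integral>\<omega>. inner (noise y \<zeta> \<omega>) (w \<omega>) \<partial>M) = 0"
proof -
  have "(\<integral>\<omega>. inner (noise y \<zeta> \<omega>) (w \<omega>) \<partial>M)
      = (\<integral>\<omega>. \<integral>z. inner (Vhat (y \<omega>) z - V (y \<omega>)) (w \<omega>) \<partial>P \<partial>M)"
    using sample_integral[OF assms(1), of "\<lambda>(\<omega>, z). inner (Vhat (y \<omega>) z - V (y \<omega>)) (w \<omega>)"]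
      integrable_inner[OF noise_square_integrable(1)[OF assms(1,2)] w2]
    unfolding noise_def by simp
  also have "\<dots> = (\<integral>\<omega>. 0 \<partial>M)"
  proof (intro Bochner_Integration.integral_cong refl)
    fix \<omega>
    have "has_bochner_integral P (\<lambda>z. Vhat (y \<omega>) z - V (y \<omega>)) (V (y \<omega>) - V (y \<omega>))"
      using unbiased[of "y \<omega>"] P.prob_space
      by (intro has_bochner_integral_diff) (auto simp: has_bochner_integral_iff)
    from has_bochner_integral_inner_left[OF this, of "w \<omega>"]
    show "(\<integral>z. inner (Vhat (y \<omega>) z - V (y \<omega>)) (w \<omega>) \<partial>P) = 0"
      by (simp add: has_bochner_integral_iff)
  qed
  finally show ?thesis by simp
qed

lemma batch_mean_measurable:
  assumes y[measurable]: "y \<in> borel_measurable G"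
    and \<zeta>: "\<And>t. t \<in> {1..n} \<Longrightarrow> \<zeta> t \<in> G \<rightarrow>\<^sub>M P"
  shows "(\<lambda>\<omega>. batch_mean Vhat n (y \<omega>) (\<lambda>t. \<zeta> t \<omega>)) \<in> borel_measurable G"
proof -
  have "(\<lambda>\<omega>. Vhat (y \<omega>) (\<zeta> t \<omega>)) \<in> borel_measurable G" if "t \<in> {1..n}" for t
  proof -
    note [measurable] = \<zeta>[OF that]
    show ?thesis by measurable
  qed
  then show ?thesis
    unfolding batch_mean_def by (intro borel_measurable_scaleR borel_measurable_sum) auto
qed

definition batch_noise :: "('w \<Rightarrow> 'h) \<Rightarrow> nat \<Rightarrow> (nat \<Rightarrow> 'w \<Rightarrow> 'z) \<Rightarrow> 'w \<Rightarrow> 'h" where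
  "batch_noise y n \<zeta> \<omega> = batch_mean Vhat n (y \<omega>) (\<lambda>t. \<zeta> t \<omega>) - V (y \<omega>)"

lemma batch_noise_eq:
  assumes "n \<ge> 1"
  shows "batch_noise y n \<zeta> \<omega> = (1 / real n) *\<^sub>R (\<Sum>t=1..n. noise y (\<zeta> t) \<omega>)"
  using assms
  by (simp add: batch_noise_def batch_mean_def noise_def sum_subtractf sum_constant_scaleR algebra_simps)

text \<open>The samples of a batch are revealed one at a time along the \<open>G t\<close>. Each
  summand is orthogonal to the previous ones, so the variances add up to at most
  \<open>n * \<sigma>\<^sup>2\<close>, and the squared prefactor \<open>1 / n\<close> leaves
  \<open>\<sigma>\<^sup>2 / n\<close>.\<close>

lemma batch_noise:
  assumes n: "n \<ge> 1"
    and fresh: "\<And>t. t \<in> {1..n} \<Longrightarrow> fresh (G t) (\<zeta> t)"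
    and mono: "\<And>s t. 1 \<le> s \<Longrightarrow> s < t \<Longrightarrow> t \<le> n \<Longrightarrow> \<zeta> s \<in> G t \<rightarrow>\<^sub>M P"
    and y: "\<And>t. t \<in> {1..n} \<Longrightarrow> y \<in> borel_measurable (G t)"
  shows "square_integrable M (batch_noise y n \<zeta>)"
    and "(\<integral>\<omega>. (norm (batch_noise y n \<zeta> \<omega>))\<^sup>2 \<partial>M) \<le> \<sigma>\<^sup>2 / real n"
    and "\<And>w. (\<And>t. t \<in> {1..n} \<Longrightarrow> w \<in> borel_measurable (G t)) \<Longrightarrow> square_integrable M w \<Longrightarrow>
           (\<integral>\<omega>. inner (batch_noise y n \<zeta> \<omega>) (w \<omega>) \<partial>M) = 0"
proof -
  \<comment> \<open>Padding by 0 outside the batch makes square integrability hold at every index,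
    including 0.\<close>
  let ?d = "\<lambda>t. if t \<in> {1..n} then noise y (\<zeta> t) else (\<lambda>\<omega>. 0)"
  have d: "square_integrable M (?d t)" for t
    using noise_square_integrable(1)[OF fresh y] square_integrable_const[of 0] by auto
  have U: "batch_noise y n \<zeta> = (\<lambda>\<omega>. (1 / real n) *\<^sub>R (\<Sum>t=1..n. ?d t \<omega>))"
    by (intro ext) (simp add: batch_noise_eq[OF n])
  show "square_integrable M (batch_noise y n \<zeta>)"
    unfolding U by (intro square_integrable_scaleR square_integrable_sum d)
  have "(\<integral>\<omega>. (norm (\<Sum>t=1..n. ?d t \<omega>))\<^sup>2 \<partial>M) = (\<Sum>t=1..n. \<integral>\<omega>. (norm (?d t \<omega>))\<^sup>2 \<partial>M)"
  proof (intro integral_norm_sum_squared_orthogonal d prob_space_axioms)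
    fix i j assume ij: "j < i" "i \<le> n" "1 \<le> j"
    have [measurable]: "y \<in> borel_measurable (G i)" "\<zeta> j \<in> G i \<rightarrow>\<^sub>M P"
      using ij y mono by auto
    have "noise y (\<zeta> j) \<in> borel_measurable (G i)" using ij unfolding noise_def by measurable
    then show "(\<integral>\<omega>. inner (?d i \<omega>) (?d j \<omega>) \<partial>M) = 0"
      using ij d[of j] by (auto intro!: noise_orthogonal[OF fresh y])
  qed
  also have "\<dots> \<le> (\<Sum>t=1..n. \<sigma>\<^sup>2)"
    using noise_square_integrable(2)[OF fresh y] by (intro sum_mono) auto
  finally have "(\<integral>\<omega>. (norm (\<Sum>t=1..n. ?d t \<omega>))\<^sup>2 \<partial>M) \<le> real n * \<sigma>\<^sup>2" by simp
  then have "(1 / real n)\<^sup>2 * (\<integral>\<omega>. (norm (\<Sum>t=1..n. ?d t \<omega>))\<^sup>2 \<partial>M) \<le> (1 / real n)\<^sup>2 * (real n * \<sigma>\<^sup>2)"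
    by (intro mult_left_mono) auto
  then show "(\<integral>\<omega>. (norm (batch_noise y n \<zeta> \<omega>))\<^sup>2 \<partial>M) \<le> \<sigma>\<^sup>2 / real n"
    unfolding U norm_scaleR power_mult_distrib power2_abs using n
    by (simp add: power2_eq_square)
  fix w :: "'w \<Rightarrow> 'h"
  assume w: "\<And>t. t \<in> {1..n} \<Longrightarrow> w \<in> borel_measurable (G t)" "square_integrable M w"
  have "(\<integral>\<omega>. inner (batch_noise y n \<zeta> \<omega>) (w \<omega>) \<partial>M)
      = (1 / real n) * (\<Sum>t=1..n. \<integral>\<omega>. inner (?d t \<omega>) (w \<omega>) \<partial>M)"
    unfolding U inner_scaleR_left inner_sum_left integral_mult_right_zero
    by (subst Bochner_Integration.integral_sum) (rule integrable_inner[OF d w(2)], rule refl)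
  also have "(\<Sum>t=1..n. \<integral>\<omega>. inner (?d t \<omega>) (w \<omega>) \<partial>M) = 0"
    using noise_orthogonal[OF fresh y] w by (intro sum.neutral) auto
  finally show "(\<integral>\<omega>. inner (batch_noise y n \<zeta> \<omega>) (w \<omega>) \<partial>M) = 0" by simp
qed

end

section \<open>Sigma-algebras generated by families of samples\<close>

definition generated :: "'w measure \<Rightarrow> 'z measure \<Rightarrow> ('i \<Rightarrow> 'w \<Rightarrow> 'z) \<Rightarrow> 'i set \<Rightarrow> 'w measure" where
  "generated M P Z S = vimage_algebra (space M) (\<lambda>\<omega>. \<lambda>i\<in>S. Z i \<omega>) (Pi\<^sub>M S (\<lambda>_. P))"

lemma space_generated[simp]: "space (generated M P Z S) = space M"
  by (simp add: generated_def)

lemma measurable_generated_component: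
  assumes "\<And>i. i \<in> S \<Longrightarrow> Z i \<in> M \<rightarrow>\<^sub>M P" "i \<in> S"
  shows "Z i \<in> generated M P Z S \<rightarrow>\<^sub>M P"
proof -
  have "(\<lambda>\<omega>. \<lambda>i\<in>S. Z i \<omega>) \<in> generated M P Z S \<rightarrow>\<^sub>M Pi\<^sub>M S (\<lambda>_. P)"
    unfolding generated_def using assms(1)
    by (intro measurable_vimage_algebra1) (auto simp: space_PiM intro: measurable_space)
  from measurable_compose[OF this measurable_component_singleton[OF assms(2)]]
  show ?thesis using assms(2) by simp
qed

lemma measurable_generated_mono:
  assumes "\<And>i. i \<in> S' \<Longrightarrow> Z i \<in> M \<rightarrow>\<^sub>M P" "S \<subseteq> S'" "f \<in> generated M P Z S \<rightarrow>\<^sub>M N"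
  shows "f \<in> generated M P Z S' \<rightarrow>\<^sub>M N"
proof -
  have "(\<lambda>\<omega>. \<omega>) \<in> generated M P Z S' \<rightarrow>\<^sub>M generated M P Z S"
    unfolding generated_def[of M P Z S]
    using assms(1,2) by (intro measurable_vimage_algebra2 measurable_restrict measurable_generated_component) auto
  from measurable_compose[OF this assms(3)] show ?thesis by simp
qed

text \<open>Every set of the generated sigma-algebra is a preimage of a product-measurable set under
  the joint map, and joint independence passes to the disjoint blocks \<open>S\<close> and
  \<open>{i}\<close>.\<close>

lemma (in prob_space) prob_generated_Int:
  assumes ind: "indep_vars (\<lambda>_. P) Z I" and S: "S \<subseteq> I" "i \<in> I" "i \<notin> S"
    and A: "A \<in> sets (generated M P Z S)" and B: "B \<in> sets P"
  shows "prob (A \<inter> Z i -` B) = prob A * measure (distr M P (Z i)) B"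
proof -
  have Z: "Z j \<in> M \<rightarrow>\<^sub>M P" if "j \<in> I" for j using ind that by (auto simp: indep_vars_def)
  obtain A' where A': "A' \<in> sets (Pi\<^sub>M S (\<lambda>_. P))" "A = (\<lambda>\<omega>. \<lambda>i\<in>S. Z i \<omega>) -` A' \<inter> space M"
  proof -
    have "(\<lambda>\<omega>. \<lambda>i\<in>S. Z i \<omega>) \<in> space M \<rightarrow> space (Pi\<^sub>M S (\<lambda>_. P))"
      using S measurable_space[OF Z] by (auto simp: space_PiM)
    from sets_vimage_algebra2[OF this] show thesis using A that unfolding generated_def by auto
  qed
  \<comment> \<open>The second block is a function on the one-element index set, so \<open>B\<close>
    is lifted to that one-factor product.\<close>
  define B' where "B' = (\<lambda>f. f i) -` B \<inter> space (Pi\<^sub>M {i} (\<lambda>_. P))"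
  have B': "B' \<in> sets (Pi\<^sub>M {i} (\<lambda>_. P))"
    unfolding B'_def using B by (intro measurable_sets[OF measurable_component_singleton]) auto
  have "indep_var (Pi\<^sub>M S (\<lambda>_. P)) (\<lambda>\<omega>. \<lambda>i\<in>S. Z i \<omega>) (Pi\<^sub>M {i} (\<lambda>_. P)) (\<lambda>\<omega>. \<lambda>i\<in>{i}. Z i \<omega>)"
    using S by (intro indep_var_restrict[OF ind]) auto
  from indep_varD[OF this A'(1) B']
  have "prob ((\<lambda>\<omega>. (\<lambda>i\<in>S. Z i \<omega>, \<lambda>i\<in>{i}. Z i \<omega>)) -` (A' \<times> B') \<inter> space M)
      = prob A * prob ((\<lambda>\<omega>. \<lambda>i\<in>{i}. Z i \<omega>) -` B' \<inter> space M)"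
    by (simp add: A')
  also have "(\<lambda>\<omega>. \<lambda>i\<in>{i}. Z i \<omega>) -` B' \<inter> space M = Z i -` B \<inter> space M"
    using measurable_space[OF Z[OF S(2)]] by (auto simp: B'_def space_PiM)
  also have "(\<lambda>\<omega>. (\<lambda>i\<in>S. Z i \<omega>, \<lambda>i\<in>{i}. Z i \<omega>)) -` (A' \<times> B') \<inter> space M = A \<inter> Z i -` B"
    using measurable_space[OF Z[OF S(2)]] by (auto simp: B'_def space_PiM A')
  also have "prob (Z i -` B \<inter> space M) = measure (distr M P (Z i)) B"
    using Z[OF S(2)] B by (simp add: measure_distr)
  finally show ?thesis .
qed

lemma subalgebra_generated:
  assumes "\<And>i. i \<in> S \<Longrightarrow> Z i \<in> M \<rightarrow>\<^sub>M P"
  shows "subalgebra M (generated M P Z S)"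
proof -
  have "(\<lambda>\<omega>. \<lambda>i\<in>S. Z i \<omega>) \<in> M \<rightarrow>\<^sub>M Pi\<^sub>M S (\<lambda>_. P)" using assms by (intro measurable_restrict)
  then show ?thesis
    unfolding subalgebra_def generated_def by (simp add: sets_image_in_sets)
qed

subsection \<open>The RISFBF process\<close>

lemma relaxation_denominator: "7 / 8 \<le> 2 * (x::real)\<^sup>2 - x + 1"
proof -
  have "2 * x\<^sup>2 - x + 1 = 2 * (x - 1 / 4)\<^sup>2 + 7 / 8" by (simp add: field_simps power2_eq_square)
  then show ?thesis by simp
qed

locale risfbf = stochastic_oracle M P Vhat V \<sigma>
  for M :: "'w measure" and P :: "'z measure"
    and Vhat :: "'h::{real_inner, banach, second_countable_topology} \<Rightarrow> 'z \<Rightarrow> 'h"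
    and V :: "'h \<Rightarrow> 'h" and \<sigma> :: real +
  fixes T :: "'h \<Rightarrow> 'h set" and \<alpha> \<rho> :: "nat \<Rightarrow> real" and m :: "nat \<Rightarrow> nat"
    and xi eta :: "nat \<Rightarrow> nat \<Rightarrow> 'w \<Rightarrow> 'z" and x0 x1 xs :: 'h
    and X Y :: "nat \<Rightarrow> 'w \<Rightarrow> 'h" and L lam b :: real
  assumes T: "monotone_op T"
    and V: "monotone_op (op_single V)" "L-lipschitz_on UNIV V"
    and L: "0 < L" and lam: "0 < lam" "2 * L * lam < 1"
    and \<alpha>_mono: "mono_on {1..} \<alpha>"
    and \<alpha>: "\<And>k. k \<ge> 1 \<Longrightarrow> 0 < \<alpha> k \<and> \<alpha> k \<le> b" and b: "b < 1"
    and \<rho>: "\<And>k. k \<ge> 1 \<Longrightarrow>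
      \<rho> k = 3 * (1 - b)\<^sup>2 / (2 * (2 * (\<alpha> k)\<^sup>2 - \<alpha> k + 1) * (1 + L * lam))"
    and m: "\<And>k. k \<ge> 1 \<Longrightarrow> 1 \<le> m k"
    and xs: "xs \<in> op_dom T"
    and draws: "independent_draws M P m xi eta"
    and process: "risfbf_process (space M) T Vhat \<alpha> \<rho> (\<lambda>_. lam) m xi eta x0 x1 X Y"
begin

definition Z :: "nat \<Rightarrow> 'w \<Rightarrow> 'h" where
  "Z k \<omega> = X k \<omega> + \<alpha> k *\<^sub>R (X k \<omega> - X (k - 1) \<omega>)"

definition A :: "nat \<Rightarrow> 'w \<Rightarrow> 'h" where
  "A k \<omega> = batch_mean Vhat (m k) (Z k \<omega>) (\<lambda>t. xi k t \<omega>)"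

definition B :: "nat \<Rightarrow> 'w \<Rightarrow> 'h" where
  "B k \<omega> = batch_mean Vhat (m k) (Y k \<omega>) (\<lambda>t. eta k t \<omega>)"

definition UA :: "nat \<Rightarrow> 'w \<Rightarrow> 'h" where
  "UA k = batch_noise (Z k) (m k) (xi k)"

definition UB :: "nat \<Rightarrow> 'w \<Rightarrow> 'h" where
  "UB k = batch_noise (Y k) (m k) (eta k)"

lemma UA_eq: "UA k \<omega> = A k \<omega> - V (Z k \<omega>)"
  by (simp add: UA_def batch_noise_def A_def)

lemma UB_eq: "UB k \<omega> = B k \<omega> - V (Y k \<omega>)"
  by (simp add: UB_def batch_noise_def B_def)

lemma process_initial:
  assumes "\<omega> \<in> space M"
  shows "X 0 \<omega> = x0" "X 1 \<omega> = x1"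
  using process assms by (auto simp: risfbf_process_def)

lemma process_step:
  assumes "\<omega> \<in> space M" "k \<ge> 1"
  shows "Y k \<omega> \<in> resolvent lam T (Z k \<omega> - lam *\<^sub>R A k \<omega>)"
    and "X (k + 1) \<omega> = (1 - \<rho> k) *\<^sub>R Z k \<omega> + \<rho> k *\<^sub>R (Y k \<omega> + lam *\<^sub>R (A k \<omega> - B k \<omega>))"
  using process assms unfolding risfbf_process_def Let_def Z_def A_def B_def by blast+

text \<open>The denominator factor \<open>q\<close> lies between \<open>7 / 8\<close> and
  \<open>2\<close>. The lower bound on \<open>\<rho> k\<close> does not depend on \<open>k\<close>
  and gives linear growth of the sum of weights; the upper bound enters the noise constants. The
  last equation is the tuning of \<open>\<rho> k\<close> that matches the one-step estimate to
  \<open>energy_step\<close>.\<close>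

lemma relaxation_bounds:
  assumes "k \<ge> 1"
  shows "0 < \<rho> k" "\<rho> k \<le> 2" "3 * (1 - b)\<^sup>2 / (4 * (1 + L * lam)) \<le> \<rho> k"
    and "3 / (2 * (1 + L * lam)) / \<rho> k - 1 = inertia_weight b (\<alpha> k)"
proof -
  define q where "q = 2 * (\<alpha> k)\<^sup>2 - \<alpha> k + 1"
  define s where "s = L * lam"
  have s: "0 < s" using L lam by (simp add: s_def)
  have a: "0 < \<alpha> k" "\<alpha> k \<le> b" "\<alpha> k < 1" using \<alpha>[OF assms] b by auto
  have q: "7 / 8 \<le> q" unfolding q_def by (rule relaxation_denominator)
  have "\<alpha> k * \<alpha> k \<le> \<alpha> k * 1" using a by (intro mult_left_mono) auto
  then have q2: "q \<le> 2" unfolding q_def power2_eq_square using a by linarith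
  have rk: "\<rho> k = 3 * (1 - b)\<^sup>2 / (2 * q * (1 + s))" using \<rho>[OF assms] by (simp add: q_def s_def)
  have b1: "0 < (1 - b)\<^sup>2" "(1 - b)\<^sup>2 \<le> 1"
    using a b by (auto intro: power_le_one)
  show "0 < \<rho> k" unfolding rk using q b1 s by (intro divide_pos_pos mult_pos_pos) auto
  have "2 * q * (1 + s) \<ge> 2 * (7 / 8) * 1" using q s by (intro mult_mono) auto
  then have "\<rho> k \<le> 3 * 1 / (2 * (7 / 8) * 1)" unfolding rk using b1 by (intro frac_le) auto
  then show "\<rho> k \<le> 2" by simp
  have "2 * q * (1 + s) \<le> 2 * 2 * (1 + s)" using q2 s by (intro mult_right_mono) auto
  then show "3 * (1 - b)\<^sup>2 / (4 * (1 + L * lam)) \<le> \<rho> k"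
    unfolding rk s_def[symmetric] using q s by (intro frac_le) auto
  have "3 / (2 * t) / (3 * w / (2 * q * t)) = q / w" if "0 < t" "0 < w" for t w :: real
    using that q by (simp add: field_simps)
  from this[of "1 + s", OF _ b1(1)] have "3 / (2 * (1 + s)) / \<rho> k = q / (1 - b)\<^sup>2"
    unfolding rk using s by simp
  then show "3 / (2 * (1 + L * lam)) / \<rho> k - 1 = inertia_weight b (\<alpha> k)"
    by (simp add: inertia_weight_def q_def s_def)
qed

definition error :: "nat \<Rightarrow> 'w \<Rightarrow> real" where
  "error k \<omega> = 6 * \<rho> k * lam\<^sup>2 * ((norm (UA k \<omega>))\<^sup>2 + (norm (UB k \<omega>))\<^sup>2)"

text \<open>Telescoping holds pathwise and for every \<open>p\<close>, so that the supremum over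
  \<open>p\<close> can be taken before the expectation.\<close>

lemma energy_sum:
  assumes \<omega>: "\<omega> \<in> space M" and v: "v \<in> T p"
  shows "energy b (\<alpha> (Suc K)) p (X (Suc K) \<omega>) (X K \<omega>)
      \<le> energy b (\<alpha> 1) p x1 x0
       + (\<Sum>k=1..K. error k \<omega> - 2 * lam * \<rho> k * inner (UB k \<omega>) (Y k \<omega> - p)
                      - 2 * lam * \<rho> k * inner (v + V p) (Y k \<omega> - p))"
proof (induction K)
  case 0
  then show ?case using process_initial[OF \<omega>] by simp
next
  case (Suc K)
  let ?k = "Suc K"
  have k: "?k \<ge> 1" by simp
  have "energy b (\<alpha> (Suc ?k)) p (X (Suc ?k) \<omega>) (X ?k \<omega>) \<le> energy b (\<alpha> ?k) p (X ?k \<omega>) (X K \<omega>)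
      + (error ?k \<omega> - 2 * lam * \<rho> ?k * inner (UB ?k \<omega>) (Y ?k \<omega> - p)
                      - 2 * lam * \<rho> ?k * inner (v + V p) (Y ?k \<omega> - p))"
  proof (rule energy_step)
    show "0 < \<alpha> ?k" "\<alpha> (Suc ?k) \<le> b" "b < 1" using \<alpha> b by auto
    show "\<alpha> ?k \<le> \<alpha> (Suc ?k)" using \<alpha>_mono by (auto simp: mono_on_def)
    show "Z ?k \<omega> = X ?k \<omega> + \<alpha> ?k *\<^sub>R (X ?k \<omega> - X K \<omega>)" by (simp add: Z_def)
    show "(norm (X (Suc ?k) \<omega> - p))\<^sup>2 \<le> (norm (Z ?k \<omega> - p))\<^sup>2
        - inertia_weight b (\<alpha> ?k) * (norm (X (Suc ?k) \<omega> - Z ?k \<omega>))\<^sup>2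
        + (error ?k \<omega> - 2 * lam * \<rho> ?k * inner (UB ?k \<omega>) (Y ?k \<omega> - p)
                      - 2 * lam * \<rho> ?k * inner (v + V p) (Y ?k \<omega> - p))"
      using forward_backward_forward_step[OF T V L lam relaxation_bounds(1)[OF k]
          process_step(1)[OF \<omega> k] v process_step(2)[OF \<omega> k]]
      unfolding relaxation_bounds(4)[OF k] by (simp add: error_def UA_eq UB_eq)
  qed
  then show ?case using Suc.IH by simp
qed

text \<open>No \<open>p\<close> occurs: the first summand bounds the initial energy over the whole
  restricted set, and the last one the noise paired with \<open>xs - p\<close>. The form
  \<open>1 + (norm S)\<^sup>2\<close> replaces \<open>norm S\<close> so that a variance bound alone
  controls its expectation.\<close>

definition majorant :: "real \<Rightarrow> nat \<Rightarrow> 'w \<Rightarrow> real" where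
  "majorant D K \<omega> = ((norm (x1 - xs) + D)\<^sup>2 + (1 - \<alpha> 1) * inertia_weight b (\<alpha> 1) * (norm (x1 - x0))\<^sup>2)
     + (\<Sum>k=1..K. error k \<omega> - 2 * lam * \<rho> k * inner (UB k \<omega>) (Y k \<omega> - xs))
     + 2 * lam * D * (1 + (norm (\<Sum>k=1..K. \<rho> k *\<^sub>R UB k \<omega>))\<^sup>2)"

lemma gap_le_majorant:
  assumes \<omega>: "\<omega> \<in> space M" and K: "K \<ge> 1" and D: "D > 0"
  shows "gap (op_add T (op_single V)) (restricted_set T xs D) (ergodic_average \<rho> Y K \<omega>)
    \<le> ereal (majorant D K \<omega> / (2 * lam * (\<Sum>k=1..K. \<rho> k)))"
  unfolding gap_def
proof (rule Sup_least, clarify)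
  fix p u assume p: "p \<in> restricted_set T xs D" and u: "u \<in> op_add T (op_single V) p"
  obtain v where v: "v \<in> T p" "u = v + V p" using u by (auto simp: op_add_def op_single_def)
  have pD: "norm (xs - p) \<le> D" using p by (simp add: restricted_set_def norm_minus_commute)
  define R where "R = (\<Sum>k=1..K. \<rho> k)"
  have R: "0 < R" unfolding R_def using K relaxation_bounds(1) by (intro sum_pos) auto
  define S where "S = (\<Sum>k=1..K. \<rho> k *\<^sub>R UB k \<omega>)"
  \<comment> \<open>For fixed \<open>u\<close> the gap integrand is affine in the point, so its
    value at the ergodic average is the weighted mean of its values at the
    \<open>Y k\<close>.\<close>
  have "(\<Sum>k=1..K. \<rho> k *\<^sub>R (Y k \<omega> - p)) = (\<Sum>k=1..K. \<rho> k *\<^sub>R Y k \<omega>) - R *\<^sub>R p"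
    by (simp add: R_def scaleR_right_diff_distrib sum_subtractf scaleR_sum_left)
  then have "ergodic_average \<rho> Y K \<omega> - p = (\<Sum>k=1..K. \<rho> k *\<^sub>R (Y k \<omega> - p)) /\<^sub>R R"
    unfolding ergodic_average_def R_def[symmetric] using R by (simp add: scaleR_right_diff_distrib)
  then have avg: "inner u (ergodic_average \<rho> Y K \<omega> - p) = (\<Sum>k=1..K. \<rho> k * inner u (Y k \<omega> - p)) / R"
    by (simp add: inner_sum_right divide_inverse mult.commute)
  have "2 * lam * (\<Sum>k=1..K. \<rho> k * inner u (Y k \<omega> - p))
      \<le> energy b (\<alpha> 1) p x1 x0 + (\<Sum>k=1..K. error k \<omega> - 2 * lam * \<rho> k * inner (UB k \<omega>) (Y k \<omega> - p))"
  proof -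
    \<comment> \<open>The terminal energy is discarded by nonnegativity.\<close>
    have "0 \<le> energy b (\<alpha> (Suc K)) p (X (Suc K) \<omega>) (X K \<omega>)"
      using \<alpha>[of "Suc K"] b by (intro energy_nonneg) auto
    with energy_sum[OF \<omega> v(1), of K] show ?thesis
      unfolding v(2)[symmetric] by (simp add: sum_subtractf sum_distrib_left mult.assoc)
  qed
  moreover have "energy b (\<alpha> 1) p x1 x0 \<le> (norm (x1 - xs) + D)\<^sup>2 + (1 - \<alpha> 1) * inertia_weight b (\<alpha> 1) * (norm (x1 - x0))\<^sup>2"
  proof -
    have "norm (x1 - p) \<le> norm (x1 - xs) + D"
      using norm_triangle_ineq[of "x1 - xs" "xs - p"] pD by simp
    then have "(norm (x1 - p))\<^sup>2 \<le> (norm (x1 - xs) + D)\<^sup>2" by (intro power_mono) auto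
    moreover have "0 \<le> \<alpha> 1 * (norm (x0 - p))\<^sup>2" using \<alpha>[of 1] by simp
    ultimately show ?thesis by (simp add: energy_def)
  qed
  moreover have "(\<Sum>k=1..K. error k \<omega> - 2 * lam * \<rho> k * inner (UB k \<omega>) (Y k \<omega> - p))
      = (\<Sum>k=1..K. error k \<omega> - 2 * lam * \<rho> k * inner (UB k \<omega>) (Y k \<omega> - xs)) - 2 * lam * inner S (xs - p)"
    by (simp add: S_def inner_sum_left sum_distrib_left inner_diff_right sum_subtractf algebra_simps
        flip: sum.distrib)
  moreover have "- (2 * lam * inner S (xs - p)) \<le> 2 * lam * D * (1 + (norm S)\<^sup>2)"
  proof -
    have "- inner S (xs - p) \<le> norm S * norm (xs - p)"
      using Cauchy_Schwarz_ineq2[of S "xs - p"] by linarith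
    also have "\<dots> \<le> norm S * D" using pD by (intro mult_left_mono) auto
    also have "\<dots> \<le> (1 + (norm S)\<^sup>2) * D"
    proof (rule mult_right_mono)
      show "norm S \<le> 1 + (norm S)\<^sup>2"
        using sum_squares_bound[of 1 "norm S"] by (simp add: power2_eq_square)
          (use norm_ge_zero[of S] in linarith)
    qed (use D in simp)
    finally show ?thesis
      using mult_left_mono[of "- inner S (xs - p)" "(1 + (norm S)\<^sup>2) * D" "2 * lam"] lam
      by (simp add: algebra_simps)
  qed
  ultimately have "2 * lam * (\<Sum>k=1..K. \<rho> k * inner u (Y k \<omega> - p)) \<le> majorant D K \<omega>"
    unfolding majorant_def S_def[symmetric] by linarith
  then have "(\<Sum>k=1..K. \<rho> k * inner u (Y k \<omega> - p)) / R \<le> majorant D K \<omega> / (2 * lam * R)"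
    using R lam by (simp add: field_simps)
  then show "ereal (inner u (ergodic_average \<rho> Y K \<omega> - p))
      \<le> ereal (majorant D K \<omega> / (2 * lam * (\<Sum>k=1..K. \<rho> k)))"
    unfolding avg R_def by simp
qed

section \<open>The order of revelation of the samples and adaptedness of the iterates\<close>

definition sample_index :: "(nat \<times> nat + nat \<times> nat) set" where
  "sample_index = {(k, t). 1 \<le> k \<and> 1 \<le> t \<and> t \<le> m k} <+> {(k, t). 1 \<le> k \<and> 1 \<le> t \<and> t \<le> m k}"

definition sample :: "nat \<times> nat + nat \<times> nat \<Rightarrow> 'w \<Rightarrow> 'z" where
  "sample = case_sum (\<lambda>(k, t). xi k t) (\<lambda>(k, t). eta k t)"

text \<open>The samples are revealed in the order
  \<open>xi 1 1, \<dots>, xi 1 (m 1), eta 1 1, \<dots>, eta 1 (m 1), xi 2 1, \<dots>\<close>, and the two index sets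
  below contain what precedes \<open>xi k t\<close> and \<open>eta k t\<close>.\<close>

definition before_xi :: "nat \<Rightarrow> nat \<Rightarrow> (nat \<times> nat + nat \<times> nat) set" where
  "before_xi k t = {i \<in> sample_index.
     (case i of Inl (j, s) \<Rightarrow> j < k \<or> j = k \<and> s < t | Inr (j, s) \<Rightarrow> j < k)}"

definition before_eta :: "nat \<Rightarrow> nat \<Rightarrow> (nat \<times> nat + nat \<times> nat) set" where
  "before_eta k t = {i \<in> sample_index.
     (case i of Inl (j, s) \<Rightarrow> j \<le> k | Inr (j, s) \<Rightarrow> j < k \<or> j = k \<and> s < t)}"

abbreviation "GX k t \<equiv> generated M P sample (before_xi k t)"
abbreviation "GY k t \<equiv> generated M P sample (before_eta k t)"

lemma before_subset: "before_xi k t \<subseteq> sample_index" "before_eta k t \<subseteq> sample_index"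
  by (auto simp: before_xi_def before_eta_def)

lemma sample_indep: "indep_vars (\<lambda>_. P) sample sample_index"
  using draws unfolding independent_draws_def Let_def sample_def sample_index_def by blast

lemma sample_measurable: "i \<in> sample_index \<Longrightarrow> sample i \<in> M \<rightarrow>\<^sub>M P"
  using sample_indep by (auto simp: indep_vars_def)

lemma sample_distr: "i \<in> sample_index \<Longrightarrow> distr M P (sample i) = P"
  using draws unfolding independent_draws_def Let_def sample_def sample_index_def by auto

lemma generated_mono:
  "S \<subseteq> S' \<Longrightarrow> S' \<subseteq> sample_index \<Longrightarrow> f \<in> generated M P sample S \<rightarrow>\<^sub>M N
    \<Longrightarrow> f \<in> generated M P sample S' \<rightarrow>\<^sub>M N"
  using sample_measurable by (intro measurable_generated_mono[of S' sample M P S]) auto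

lemma generated_lift:
  assumes "S \<subseteq> sample_index" "f \<in> generated M P sample S \<rightarrow>\<^sub>M N"
  shows "f \<in> M \<rightarrow>\<^sub>M N"
  using measurable_from_subalg[OF subalgebra_generated assms(2)] assms(1) sample_measurable by blast

lemma fresh_generated:
  assumes "S \<subseteq> sample_index" "i \<in> sample_index" "i \<notin> S"
  shows "fresh (generated M P sample S) (sample i)"
  unfolding fresh_def
  using assms sample_measurable sample_distr[OF assms(2)] prob_generated_Int[OF sample_indep assms]
    subalgebra_generated[of S sample M P]
  by auto

lemma fresh_xi: "k \<ge> 1 \<Longrightarrow> t \<in> {1..m k} \<Longrightarrow> fresh (GX k t) (xi k t)"
  using fresh_generated[OF before_subset(1), of "Inl (k, t)" k t]
  by (auto simp: sample_def sample_index_def before_xi_def)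

lemma fresh_eta: "k \<ge> 1 \<Longrightarrow> t \<in> {1..m k} \<Longrightarrow> fresh (GY k t) (eta k t)"
  using fresh_generated[OF before_subset(2), of "Inr (k, t)" k t]
  by (auto simp: sample_def sample_index_def before_eta_def)

lemma xi_measurable:
  assumes "Inl (k, t) \<in> S" "S \<subseteq> sample_index"
  shows "xi k t \<in> generated M P sample S \<rightarrow>\<^sub>M P"
  using measurable_generated_component[of S sample M P "Inl (k, t)"] assms sample_measurable
  by (auto simp: sample_def)

lemma eta_measurable:
  assumes "Inr (k, t) \<in> S" "S \<subseteq> sample_index"
  shows "eta k t \<in> generated M P sample S \<rightarrow>\<^sub>M P"
  using measurable_generated_component[of S sample M P "Inr (k, t)"] assms sample_measurable
  by (auto simp: sample_def)

lemma GX_mono: "f \<in> GX k 1 \<rightarrow>\<^sub>M N \<Longrightarrow> 1 \<le> t \<Longrightarrow> f \<in> GX k t \<rightarrow>\<^sub>M N"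
  by (rule generated_mono[OF _ before_subset(1)]) (auto simp: before_xi_def split: sum.splits)

lemma GY_mono: "f \<in> GY k 1 \<rightarrow>\<^sub>M N \<Longrightarrow> 1 \<le> t \<Longrightarrow> f \<in> GY k t \<rightarrow>\<^sub>M N"
  by (rule generated_mono[OF _ before_subset(2)]) (auto simp: before_eta_def split: sum.splits)

lemma GX_GY: "f \<in> GX k 1 \<rightarrow>\<^sub>M N \<Longrightarrow> k \<le> k' \<Longrightarrow> f \<in> GY k' 1 \<rightarrow>\<^sub>M N"
  by (rule generated_mono[OF _ before_subset(2)])
    (auto simp: before_eta_def before_xi_def sample_index_def split: sum.splits)

lemma GY_GX: "f \<in> GY k 1 \<rightarrow>\<^sub>M N \<Longrightarrow> f \<in> GX (Suc k) 1 \<rightarrow>\<^sub>M N"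
  by (rule generated_mono[OF _ before_subset(1)])
    (auto simp: before_eta_def before_xi_def sample_index_def split: sum.splits)

text \<open>This is the induction invariant. Two consecutive iterates are tracked because the
  extrapolated point \<open>Z k\<close> uses both.\<close>

definition adapted :: "nat \<Rightarrow> bool" where
  "adapted k \<longleftrightarrow> X k \<in> borel_measurable (GX k 1) \<and> X (k - 1) \<in> borel_measurable (GX k 1) \<and>
     square_integrable M (X k) \<and> square_integrable M (X (k - 1))"

text \<open>A Lipschitz map grows at most linearly.\<close>

lemma V_square_integrable:
  assumes "square_integrable M f"
  shows "square_integrable M (\<lambda>\<omega>. V (f \<omega>))"
proof (rule square_integrable_bound)
  show "square_integrable M (\<lambda>\<omega>. norm (V 0) + L *\<^sub>R norm (f \<omega>))"
    using assms by (intro square_integrable_add square_integrable_const square_integrable_scaleR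
        square_integrable_norm)
  have [measurable]: "f \<in> borel_measurable M" using assms by (simp add: square_integrable_def)
  show "(\<lambda>\<omega>. V (f \<omega>)) \<in> borel_measurable M" by measurable
  fix \<omega>
  have "norm (V (f \<omega>)) \<le> norm (V 0) + norm (V (f \<omega>) - V 0)"
    by (rule norm_triangle_sub)
  also have "norm (V (f \<omega>) - V 0) \<le> L * norm (f \<omega>)"
    using lipschitz_onD[OF V(2), of "f \<omega>" 0] by (simp add: dist_norm)
  finally show "norm (V (f \<omega>)) \<le> norm (norm (V 0) + L *\<^sub>R norm (f \<omega>))" using L by simp
qed

text \<open>One round in the order of revelation: \<open>Z k\<close> is known before the first
  batch, \<open>A k\<close> and \<open>Y k\<close> before the second, and \<open>B k\<close> and the
  next iterate after it. At each stage the noise is square integrable by \<open>batch_noise\<close>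
  and the values of \<open>V\<close> by linear growth.\<close>

lemma adapted_step:
  assumes k: "k \<ge> 1" and ad: "adapted k"
  shows "Y k \<in> borel_measurable (GY k 1)" "square_integrable M (Y k)"
    and "square_integrable M (UA k)" "(\<integral>\<omega>. (norm (UA k \<omega>))\<^sup>2 \<partial>M) \<le> \<sigma>\<^sup>2 / real (m k)"
    and "square_integrable M (UB k)" "(\<integral>\<omega>. (norm (UB k \<omega>))\<^sup>2 \<partial>M) \<le> \<sigma>\<^sup>2 / real (m k)"
    and "UB k \<in> borel_measurable (GX (Suc k) 1)"
    and "\<And>w. w \<in> borel_measurable (GY k 1) \<Longrightarrow> square_integrable M w \<Longrightarrow>
       (\<integral>\<omega>. inner (UB k \<omega>) (w \<omega>) \<partial>M) = 0"
    and "adapted (Suc k)"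
proof -
  have [measurable]: "X k \<in> borel_measurable (GX k 1)" "X (k - 1) \<in> borel_measurable (GX k 1)"
    and X2: "square_integrable M (X k)" "square_integrable M (X (k - 1))"
    using ad by (auto simp: adapted_def)
  have Zm: "Z k \<in> borel_measurable (GX k 1)" unfolding Z_def by measurable
  have Z2: "square_integrable M (Z k)"
    unfolding Z_def using X2
    by (intro square_integrable_add square_integrable_scaleR square_integrable_diff)
  have xi: "xi k s \<in> GX k t \<rightarrow>\<^sub>M P" if "1 \<le> s" "s < t" "t \<le> m k" for s t
    using that k by (intro xi_measurable[OF _ before_subset(1)]) (auto simp: before_xi_def sample_index_def)
  note UA = batch_noise[where G = "GX k" and \<zeta> = "xi k" and y = "Z k",
      OF m[OF k] fresh_xi[OF k] xi GX_mono[OF Zm], folded UA_def]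
  show UA2: "square_integrable M (UA k)" "(\<integral>\<omega>. (norm (UA k \<omega>))\<^sup>2 \<partial>M) \<le> \<sigma>\<^sup>2 / real (m k)"
    using UA(1,2) by auto
  have [measurable]: "Z k \<in> borel_measurable (GY k 1)" by (rule GX_GY[OF Zm order_refl])
  have [measurable]: "A k \<in> borel_measurable (GY k 1)"
    unfolding A_def
  proof (rule batch_mean_measurable)
    fix t assume "t \<in> {1..m k}"
    then show "xi k t \<in> GY k 1 \<rightarrow>\<^sub>M P"
      using k by (intro xi_measurable[OF _ before_subset(2)]) (auto simp: before_eta_def sample_index_def)
  qed (rule GX_GY[OF Zm order_refl])
  have "A k = (\<lambda>\<omega>. UA k \<omega> + V (Z k \<omega>))" by (simp add: UA_eq fun_eq_iff)
  then have A2: "square_integrable M (A k)"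
    using UA2 V_square_integrable[OF Z2] by (simp add: square_integrable_add)
  obtain J where J: "J \<in> borel_measurable borel"
    "\<And>x y. y \<in> resolvent lam T x \<Longrightarrow> y = J x"
    "\<And>x y x' y'. y \<in> resolvent lam T x \<Longrightarrow> y' \<in> resolvent lam T x' \<Longrightarrow> norm (y - y') \<le> norm (x - x')"
    using resolvent_measurable_selection[OF T lam(1)] by blast
  note [measurable] = J(1)
  \<comment> \<open>The process is specified only on \<open>space M\<close>, so measurability is
    transferred from a measurable expression that agrees with \<open>Y k\<close> there.\<close>
  have "Y k \<omega> = J (Z k \<omega> - lam *\<^sub>R A k \<omega>)" if "\<omega> \<in> space M" for \<omega>
    using J(2)[OF process_step(1)[OF that k]] .
  then have "Y k \<in> borel_measurable (GY k 1) \<longleftrightarrow> (\<lambda>\<omega>. J (Z k \<omega> - lam *\<^sub>R A k \<omega>)) \<in> borel_measurable (GY k 1)"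
    by (intro measurable_cong) simp
  moreover have "(\<lambda>\<omega>. J (Z k \<omega> - lam *\<^sub>R A k \<omega>)) \<in> borel_measurable (GY k 1)" by measurable
  ultimately show Ym: "Y k \<in> borel_measurable (GY k 1)" by (rule iffD2)
  \<comment> \<open>As \<open>xs\<close> is in the domain, it is itself a resolvent value, at
    \<open>xs + lam *\<^sub>R u\<close>. Nonexpansiveness then bounds \<open>Y k - xs\<close> by a
    square integrable difference of arguments.\<close>
  obtain u where "u \<in> T xs" using xs by (auto simp: op_dom_def)
  then have res: "xs \<in> resolvent lam T (xs + lam *\<^sub>R u)" by (auto simp: mem_resolvent_iff)
  have "square_integrable M (\<lambda>\<omega>. Y k \<omega> - xs)"
  proof (rule square_integrable_bound)
    show "square_integrable M (\<lambda>\<omega>. Z k \<omega> - lam *\<^sub>R A k \<omega> - (xs + lam *\<^sub>R u))"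
      by (intro square_integrable_diff square_integrable_const square_integrable_scaleR Z2 A2)
    have [measurable]: "Y k \<in> borel_measurable M" using generated_lift[OF before_subset(2) Ym] .
    show "(\<lambda>\<omega>. Y k \<omega> - xs) \<in> borel_measurable M" by measurable
  qed (rule J(3)[OF process_step(1)[OF _ k] res])
  from square_integrable_add[OF this square_integrable_const[of xs]]
  show Y2: "square_integrable M (Y k)" by simp
  have eta: "eta k s \<in> GY k t \<rightarrow>\<^sub>M P" if "1 \<le> s" "s < t" "t \<le> m k" for s t
    using that k by (intro eta_measurable[OF _ before_subset(2)]) (auto simp: before_eta_def sample_index_def)
  note UB = batch_noise[where G = "GY k" and \<zeta> = "eta k" and y = "Y k",
      OF m[OF k] fresh_eta[OF k] eta GY_mono[OF Ym], folded UB_def]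
  show UB2: "square_integrable M (UB k)" "(\<integral>\<omega>. (norm (UB k \<omega>))\<^sup>2 \<partial>M) \<le> \<sigma>\<^sup>2 / real (m k)"
    using UB(1,2) by auto
  show "(\<integral>\<omega>. inner (UB k \<omega>) (w \<omega>) \<partial>M) = 0"
    if "w \<in> borel_measurable (GY k 1)" "square_integrable M w" for w
    using GY_mono[OF that(1)] that(2) by (intro UB(3)) auto
  have [measurable]: "Y k \<in> borel_measurable (GX (Suc k) 1)" "A k \<in> borel_measurable (GX (Suc k) 1)"
    "Z k \<in> borel_measurable (GX (Suc k) 1)" "X k \<in> borel_measurable (GX (Suc k) 1)"
    by (rule GY_GX, fact)+ (rule GY_GX GX_GY[OF \<open>X k \<in> borel_measurable (GX k 1)\<close> order_refl])+
  have [measurable]: "B k \<in> borel_measurable (GX (Suc k) 1)"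
    unfolding B_def
  proof (rule batch_mean_measurable)
    fix t assume "t \<in> {1..m k}"
    then show "eta k t \<in> GX (Suc k) 1 \<rightarrow>\<^sub>M P"
      using k by (intro eta_measurable[OF _ before_subset(1)]) (auto simp: before_xi_def sample_index_def)
  qed (rule GY_GX[OF Ym])
  show "UB k \<in> borel_measurable (GX (Suc k) 1)"
    unfolding UB_eq[abs_def] by measurable
  have "B k = (\<lambda>\<omega>. UB k \<omega> + V (Y k \<omega>))" by (simp add: UB_eq fun_eq_iff)
  then have B2: "square_integrable M (B k)"
    using UB2 V_square_integrable[OF Y2] by (simp add: square_integrable_add)
  let ?X = "\<lambda>\<omega>. (1 - \<rho> k) *\<^sub>R Z k \<omega> + \<rho> k *\<^sub>R (Y k \<omega> + lam *\<^sub>R (A k \<omega> - B k \<omega>))"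
  have XX: "X (Suc k) \<omega> = ?X \<omega>" if "\<omega> \<in> space M" for \<omega>
    using process_step(2)[OF that k] by simp
  have "X (Suc k) \<in> borel_measurable (GX (Suc k) 1) \<longleftrightarrow> ?X \<in> borel_measurable (GX (Suc k) 1)"
    using XX by (intro measurable_cong) simp
  moreover have "?X \<in> borel_measurable (GX (Suc k) 1)" by measurable
  ultimately have Xm: "X (Suc k) \<in> borel_measurable (GX (Suc k) 1)" by (rule iffD2)
  have "square_integrable M ?X"
    by (intro square_integrable_add square_integrable_diff square_integrable_scaleR Z2 A2 Y2 B2)
  then have "square_integrable M (X (Suc k))"
    by (rule square_integrable_bound[OF _ generated_lift[OF before_subset(1) Xm]])
      (simp only: XX order_refl)
  then show "adapted (Suc k)"
    unfolding adapted_def diff_Suc_1 using Xm X2 \<open>X k \<in> borel_measurable (GX (Suc k) 1)\<close> by blast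
qed

lemma adapted:
  assumes "k \<ge> 1"
  shows "adapted k"
  using assms
proof (induction k rule: dec_induct)
  case base
  have eq: "X 1 \<omega> = x1" "X 0 \<omega> = x0" if "\<omega> \<in> space M" for \<omega> using process_initial that by auto
  \<comment> \<open>The initial points are deterministic, hence measurable even though no sample
    precedes the first one.\<close>
  have "X 1 \<in> borel_measurable (GX 1 1) \<longleftrightarrow> (\<lambda>_. x1) \<in> borel_measurable (GX 1 1)"
    "X 0 \<in> borel_measurable (GX 1 1) \<longleftrightarrow> (\<lambda>_. x0) \<in> borel_measurable (GX 1 1)"
    by (intro measurable_cong; simp add: eq[simplified])+
  then have Xm: "X 1 \<in> borel_measurable (GX 1 1)" "X 0 \<in> borel_measurable (GX 1 1)" by simp_all
  have "square_integrable M (X 1)"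
    by (rule square_integrable_bound[OF square_integrable_const[of x1] generated_lift[OF before_subset(1) Xm(1)]])
      (simp add: eq[simplified])
  moreover have "square_integrable M (X 0)"
    by (rule square_integrable_bound[OF square_integrable_const[of x0] generated_lift[OF before_subset(1) Xm(2)]])
      (simp add: eq[simplified])
  ultimately show ?case using Xm by (simp add: adapted_def)
next
  case (step k)
  then show ?case using adapted_step(9)[of k] by simp
qed

section \<open>Expectations of the noise terms and of the gap\<close>

lemma error_expectation:
  assumes "k \<ge> 1"
  shows "integrable M (error k)" "(\<integral>\<omega>. error k \<omega> \<partial>M) \<le> 24 * lam\<^sup>2 * \<sigma>\<^sup>2 * (1 / real (m k))"
proof -
  note st = adapted_step[OF assms adapted[OF assms]]
  have int: "integrable M (\<lambda>\<omega>. (norm (UA k \<omega>))\<^sup>2)" "integrable M (\<lambda>\<omega>. (norm (UB k \<omega>))\<^sup>2)"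
    using st(3,5) by (auto simp: square_integrable_def)
  then show "integrable M (error k)" unfolding error_def[abs_def] by simp
  have "(\<integral>\<omega>. error k \<omega> \<partial>M) = 6 * \<rho> k * lam\<^sup>2 * ((\<integral>\<omega>. (norm (UA k \<omega>))\<^sup>2 \<partial>M) + (\<integral>\<omega>. (norm (UB k \<omega>))\<^sup>2 \<partial>M))"
    unfolding error_def using int by simp
  \<comment> \<open>The constant 24 is \<open>6 * 2 * 2\<close>: the bound
    \<open>\<rho> k \<le> 2\<close> and one variance bound for each of the two batches.\<close>
  also have "\<dots> \<le> 6 * 2 * lam\<^sup>2 * (\<sigma>\<^sup>2 / real (m k) + \<sigma>\<^sup>2 / real (m k))"
    using relaxation_bounds[OF assms] st(4,6) by (intro mult_mono add_mono) auto
  finally show "(\<integral>\<omega>. error k \<omega> \<partial>M) \<le> 24 * lam\<^sup>2 * \<sigma>\<^sup>2 * (1 / real (m k))" by simp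
qed

text \<open>The noise of round \<open>j\<close> is known before the second batch of the later round
  \<open>k\<close> is drawn.\<close>

lemma UB_orthogonal:
  assumes "1 \<le> j" "j < k"
  shows "(\<integral>\<omega>. inner (UB k \<omega>) (UB j \<omega>) \<partial>M) = 0"
proof -
  note sj = adapted_step[OF assms(1) adapted[OF assms(1)]]
  have k: "1 \<le> k" using assms by simp
  have "UB j \<in> borel_measurable (GY k 1)" using GX_GY[OF sj(7)] assms(2) by simp
  then show ?thesis using adapted_step(8)[OF k adapted[OF k]] sj(5) by blast
qed

lemma martingale_expectation:
  shows "integrable M (\<lambda>\<omega>. (norm (\<Sum>k=1..K. \<rho> k *\<^sub>R UB k \<omega>))\<^sup>2)"
    and "(\<integral>\<omega>. (norm (\<Sum>k=1..K. \<rho> k *\<^sub>R UB k \<omega>))\<^sup>2 \<partial>M) \<le> (\<Sum>k=1..K. 4 * \<sigma>\<^sup>2 * (1 / real (m k)))"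
proof -
  let ?f = "\<lambda>k. if 1 \<le> k then (\<lambda>\<omega>. \<rho> k *\<^sub>R UB k \<omega>) else (\<lambda>_. 0)"
  have UB2: "square_integrable M (UB k)" if "k \<ge> 1" for k using adapted_step(5)[OF that adapted[OF that]] .
  have f: "square_integrable M (?f k)" for k
    using square_integrable_scaleR[OF UB2] square_integrable_const[of 0] by auto
  have eq: "(\<Sum>k=1..K. \<rho> k *\<^sub>R UB k \<omega>) = (\<Sum>k=1..K. ?f k \<omega>)" for \<omega> by simp
  show "integrable M (\<lambda>\<omega>. (norm (\<Sum>k=1..K. \<rho> k *\<^sub>R UB k \<omega>))\<^sup>2)"
    using square_integrable_sum[of "{1..K}" ?f, OF f] unfolding eq square_integrable_def by blast
  have "(\<integral>\<omega>. (norm (\<Sum>k=1..K. ?f k \<omega>))\<^sup>2 \<partial>M) = (\<Sum>k=1..K. \<integral>\<omega>. (norm (?f k \<omega>))\<^sup>2 \<partial>M)"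
    by (intro integral_norm_sum_squared_orthogonal f prob_space_axioms) (simp add: UB_orthogonal)
  also have "\<dots> \<le> (\<Sum>k=1..K. 4 * \<sigma>\<^sup>2 * (1 / real (m k)))"
  proof (rule sum_mono)
    fix k assume "k \<in> {1..K}"
    then have k: "k \<ge> 1" by simp
    have "(\<rho> k)\<^sup>2 \<le> 2\<^sup>2" using relaxation_bounds[OF k] by (intro power_mono) auto
    then have "(\<rho> k)\<^sup>2 * (\<integral>\<omega>. (norm (UB k \<omega>))\<^sup>2 \<partial>M) \<le> 2\<^sup>2 * (\<sigma>\<^sup>2 / real (m k))"
      using adapted_step(6)[OF k adapted[OF k]] by (intro mult_mono) auto
    then show "(\<integral>\<omega>. (norm (?f k \<omega>))\<^sup>2 \<partial>M) \<le> 4 * \<sigma>\<^sup>2 * (1 / real (m k))"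
      using k by (simp add: power_mult_distrib)
  qed
  finally show "(\<integral>\<omega>. (norm (\<Sum>k=1..K. \<rho> k *\<^sub>R UB k \<omega>))\<^sup>2 \<partial>M) \<le> (\<Sum>k=1..K. 4 * \<sigma>\<^sup>2 * (1 / real (m k)))"
    unfolding eq .
qed

lemma expected_gap_bound:
  assumes D: "D > 0" and S: "\<And>K. (\<Sum>k=1..K. 1 / real (m k)) \<le> S"
  obtains c where "c > 0" and "\<And>K. K \<ge> 1 \<Longrightarrow> ereal_expectation M
      (\<lambda>\<omega>. gap (op_add T (op_single V)) (restricted_set T xs D) (ergodic_average \<rho> Y K \<omega>)) \<le> ereal (c / real K)"
proof -
  define h where "h = (norm (x1 - xs) + D)\<^sup>2 + (1 - \<alpha> 1) * inertia_weight b (\<alpha> 1) * (norm (x1 - x0))\<^sup>2"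
  \<comment> \<open>The three summands bound the expectations of the three parts of
    \<open>majorant\<close>, uniformly in \<open>K\<close>.\<close>
  define c0 where "c0 = h + 24 * lam\<^sup>2 * \<sigma>\<^sup>2 * S + 2 * lam * D * (1 + 4 * \<sigma>\<^sup>2 * S)"
  define r where "r = 3 * (1 - b)\<^sup>2 / (4 * (1 + L * lam))"
  have r: "r > 0" unfolding r_def using b L lam
    by (intro divide_pos_pos mult_pos_pos) (auto intro: add_pos_pos)
  have S0: "0 \<le> S" using S[of 0] by simp
  \<comment> \<open>Positivity of \<open>c0\<close> is what later permits replacing the sum of
    weights in the denominator by the smaller \<open>real K * r\<close>.\<close>
  have "0 \<le> h" unfolding h_def using \<alpha>[of 1] b inertia_weight_nonneg[of "\<alpha> 1" b]
    by (intro add_nonneg_nonneg mult_nonneg_nonneg) auto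
  moreover have "0 < 2 * lam * D * (1 + 4 * \<sigma>\<^sup>2 * S)"
    using D lam S0 by (intro mult_pos_pos add_pos_nonneg mult_nonneg_nonneg) auto
  ultimately have c0: "c0 > 0" unfolding c0_def using S0 by (intro add_nonneg_pos add_nonneg_nonneg) auto
  have maj: "integrable M (majorant D K)" "(\<integral>\<omega>. majorant D K \<omega> \<partial>M) \<le> c0" for K
  proof -
    have Y: "square_integrable M (\<lambda>\<omega>. Y k \<omega> - xs)" "(\<lambda>\<omega>. Y k \<omega> - xs) \<in> borel_measurable (GY k 1)"
      if "k \<ge> 1" for k
      using adapted_step(1,2)[OF that adapted[OF that]]
      by (auto intro: square_integrable_diff square_integrable_const)
    \<comment> \<open>The difference \<open>Y k - xs\<close> is known before the second batch of
      round \<open>k\<close>, so its product with that noise has mean zero. This relies on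
      \<open>xs\<close> being deterministic; a point nearly attaining the supremum may depend on
      \<open>\<omega>\<close>.\<close>
    have inn: "integrable M (\<lambda>\<omega>. inner (UB k \<omega>) (Y k \<omega> - xs))"
      "(\<integral>\<omega>. inner (UB k \<omega>) (Y k \<omega> - xs) \<partial>M) = 0" if "k \<ge> 1" for k
      using adapted_step(5,8)[OF that adapted[OF that]] Y[OF that] by (auto intro: integrable_inner)
    have step: "integrable M (\<lambda>\<omega>. error k \<omega> - 2 * lam * \<rho> k * inner (UB k \<omega>) (Y k \<omega> - xs))"
      "(\<integral>\<omega>. error k \<omega> - 2 * lam * \<rho> k * inner (UB k \<omega>) (Y k \<omega> - xs) \<partial>M) \<le> 24 * lam\<^sup>2 * \<sigma>\<^sup>2 * (1 / real (m k))"
      if "k \<ge> 1" for k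
      using error_expectation[OF that] inn[OF that]
      by (auto simp: Bochner_Integration.integral_diff)
    have sum: "integrable M (\<lambda>\<omega>. \<Sum>k=1..K. error k \<omega> - 2 * lam * \<rho> k * inner (UB k \<omega>) (Y k \<omega> - xs))"
      using step(1) by (intro Bochner_Integration.integrable_sum) auto
    note mart = martingale_expectation[of K]
    have maj_eq: "majorant D K = (\<lambda>\<omega>. h
        + (\<Sum>k=1..K. error k \<omega> - 2 * lam * \<rho> k * inner (UB k \<omega>) (Y k \<omega> - xs))
        + 2 * lam * D * (1 + (norm (\<Sum>k=1..K. \<rho> k *\<^sub>R UB k \<omega>))\<^sup>2))"
      by (simp add: fun_eq_iff majorant_def h_def)
    show "integrable M (majorant D K)"
      unfolding maj_eq using sum mart(1) by (intro Bochner_Integration.integrable_add integrable_mult_right) auto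
    have eq: "(\<integral>\<omega>. majorant D K \<omega> \<partial>M) = h
        + (\<integral>\<omega>. (\<Sum>k=1..K. error k \<omega> - 2 * lam * \<rho> k * inner (UB k \<omega>) (Y k \<omega> - xs)) \<partial>M)
        + 2 * lam * D * (1 + (\<integral>\<omega>. (norm (\<Sum>k=1..K. \<rho> k *\<^sub>R UB k \<omega>))\<^sup>2 \<partial>M))"
      unfolding maj_eq using sum mart(1)
      by (simp add: Bochner_Integration.integral_add prob_space del: Bochner_Integration.integral_sum)
    have "(\<integral>\<omega>. (\<Sum>k=1..K. error k \<omega> - 2 * lam * \<rho> k * inner (UB k \<omega>) (Y k \<omega> - xs)) \<partial>M)
        = (\<Sum>k=1..K. \<integral>\<omega>. error k \<omega> - 2 * lam * \<rho> k * inner (UB k \<omega>) (Y k \<omega> - xs) \<partial>M)"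
      using step(1) by (intro Bochner_Integration.integral_sum) auto
    also have "\<dots> \<le> (\<Sum>k=1..K. 24 * lam\<^sup>2 * \<sigma>\<^sup>2 * (1 / real (m k)))"
      using step(2) by (intro sum_mono) auto
    also have "\<dots> \<le> 24 * lam\<^sup>2 * \<sigma>\<^sup>2 * S"
      unfolding sum_distrib_left[symmetric] by (rule mult_left_mono[OF S]) simp
    finally have noise_le: "(\<integral>\<omega>. (\<Sum>k=1..K. error k \<omega> - 2 * lam * \<rho> k * inner (UB k \<omega>) (Y k \<omega> - xs)) \<partial>M)
        \<le> 24 * lam\<^sup>2 * \<sigma>\<^sup>2 * S" .
    have "(\<Sum>k=1..K. 4 * \<sigma>\<^sup>2 * (1 / real (m k))) \<le> 4 * \<sigma>\<^sup>2 * S"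
      unfolding sum_distrib_left[symmetric] by (rule mult_left_mono[OF S]) simp
    with mart(2) have "(\<integral>\<omega>. (norm (\<Sum>k=1..K. \<rho> k *\<^sub>R UB k \<omega>))\<^sup>2 \<partial>M) \<le> 4 * \<sigma>\<^sup>2 * S"
      by (rule order_trans)
    then have "2 * lam * D * (1 + (\<integral>\<omega>. (norm (\<Sum>k=1..K. \<rho> k *\<^sub>R UB k \<omega>))\<^sup>2 \<partial>M))
        \<le> 2 * lam * D * (1 + 4 * \<sigma>\<^sup>2 * S)"
      using lam D by (intro mult_left_mono add_left_mono) auto
    with noise_le show "(\<integral>\<omega>. majorant D K \<omega> \<partial>M) \<le> c0"
      unfolding eq c0_def by (intro add_mono order_refl)
  qed
  show thesis
  proof (rule that)
    show "0 < c0 / (2 * lam * r)" using c0 lam r by simp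
    fix K :: nat assume K: "K \<ge> 1"
    define R where "R = (\<Sum>k=1..K. \<rho> k)"
    have "real K * r = (\<Sum>k=1..K. r)" by simp
    also have "\<dots> \<le> R" unfolding R_def r_def using relaxation_bounds(3) by (intro sum_mono) auto
    finally have R: "real K * r \<le> R" .
    have Kr: "0 < real K * r" using K r by simp
    then have R0: "0 < R" using R by linarith
    have "ereal_expectation M (\<lambda>\<omega>. gap (op_add T (op_single V)) (restricted_set T xs D) (ergodic_average \<rho> Y K \<omega>))
        \<le> ereal (\<integral>\<omega>. majorant D K \<omega> / (2 * lam * R) \<partial>M)"
      unfolding R_def using maj(1) gap_le_majorant[OF _ K D] by (intro ereal_expectation_le_integral) auto
    also have "(\<integral>\<omega>. majorant D K \<omega> / (2 * lam * R) \<partial>M) \<le> c0 / (2 * lam * R)"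
      using maj(2)[of K] lam R Kr by (simp add: divide_right_mono)
    also have "\<dots> \<le> c0 / (2 * lam * (real K * r))"
      using c0 lam R R0 K r by (intro divide_left_mono mult_left_mono mult_pos_pos) auto
    also have "\<dots> = c0 / (2 * lam * r) / real K" by simp
    finally show "ereal_expectation M (\<lambda>\<omega>. gap (op_add T (op_single V)) (restricted_set T xs D) (ergodic_average \<rho> Y K \<omega>))
        \<le> ereal (c0 / (2 * lam * r) / real K)" by simp
  qed
qed

end

subsection \<open>Batch sizes and complexity\<close>

text \<open>For \<open>x \<ge> 1\<close> one has
  \<open>x < \<lfloor>x\<rfloor> + 1 \<le> 2 * \<lfloor>x\<rfloor>\<close>, so rounding down costs
  at most a factor 2.\<close>

lemma nat_floor_powr:
  assumes "k \<ge> 1" "a \<ge> 0"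
  shows "1 \<le> nat \<lfloor>real k powr a\<rfloor>" "real k powr a \<le> 2 * real (nat \<lfloor>real k powr a\<rfloor>)"
    and "real (nat \<lfloor>real k powr a\<rfloor>) \<le> real k powr a"
proof -
  have 1: "1 \<le> real k powr a" using assms by (simp add: ge_one_powr_ge_zero)
  then have f: "1 \<le> \<lfloor>real k powr a\<rfloor>" by (simp add: le_floor_iff)
  then show "1 \<le> nat \<lfloor>real k powr a\<rfloor>" by linarith
  have "real k powr a < of_int \<lfloor>real k powr a\<rfloor> + 1" by linarith
  moreover have "1 \<le> real_of_int \<lfloor>real k powr a\<rfloor>" using f by linarith
  moreover have "real (nat \<lfloor>real k powr a\<rfloor>) = real_of_int \<lfloor>real k powr a\<rfloor>" using f by simp
  ultimately show "real k powr a \<le> 2 * real (nat \<lfloor>real k powr a\<rfloor>)" by linarith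
  show "real (nat \<lfloor>real k powr a\<rfloor>) \<le> real k powr a" using f by simp
qed

lemma sum_inverse_batch_bounded:
  fixes m :: "nat \<Rightarrow> nat"
  assumes a: "a > 1" and m: "\<And>k. k \<ge> 1 \<Longrightarrow> m k = nat \<lfloor>real k powr a\<rfloor>"
  shows "(\<Sum>k=1..K. 1 / real (m k)) \<le> 2 * (\<Sum>k. real k powr (- a))"
proof -
  have "(\<Sum>k=1..K. 1 / real (m k)) \<le> (\<Sum>k=1..K. 2 * real k powr (- a))"
  proof (rule sum_mono)
    fix k assume "k \<in> {1..K}"
    then have k: "k \<ge> 1" by simp
    have "0 < real k powr a" "1 \<le> m k" "real k powr a \<le> 2 * real (m k)"
      using nat_floor_powr[OF k, of a] a k m[OF k] by auto
    then show "1 / real (m k) \<le> 2 * real k powr (- a)" by (simp add: powr_minus field_simps)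
  qed
  \<comment> \<open>The series starts at index 0, where the term is 0 because
    \<open>0 powr x = 0\<close>.\<close>
  also have "\<dots> \<le> 2 * (\<Sum>k. real k powr (- a))"
    unfolding sum_distrib_left[symmetric] using a
    by (intro mult_left_mono sum_le_suminf) (auto simp: summable_real_powr_iff)
  finally show ?thesis .
qed

text \<open>The index \<open>n = nat \<lceil>c / \<epsilon>\<rceil>\<close> already meets the
  tolerance, so the first such index is at most \<open>n\<close>; the \<open>n\<close> batches up to
  it have size at most \<open>n powr a\<close> each.\<close>

lemma oracle_complexity_bigo:
  fixes m :: "nat \<Rightarrow> nat" and E :: "nat \<Rightarrow> ereal"
  assumes a: "a > 1" and m: "\<And>k. k \<ge> 1 \<Longrightarrow> m k = nat \<lfloor>real k powr a\<rfloor>"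
    and c: "c > 0" and E: "\<And>K. K \<ge> 1 \<Longrightarrow> E K \<le> ereal (c / real K)"
  shows "(\<lambda>\<epsilon>. real (\<Sum>k=1..first_index_le E \<epsilon>. m k)) \<in> O[at_right 0](\<lambda>\<epsilon>. 1 / \<epsilon> powr (1 + a))"
proof (rule bigoI)
  \<comment> \<open>For \<open>\<epsilon> < 1\<close> the extra 1 from rounding up is at most
    \<open>1 / \<epsilon>\<close>, which turns \<open>c\<close> into \<open>c + 1\<close> in the
    constant.\<close>
  have "eventually (\<lambda>\<epsilon>::real. 0 < \<epsilon> \<and> \<epsilon> < 1) (at_right 0)"
    unfolding eventually_at_right_field by (rule exI[of _ 1]) auto
  then show "\<forall>\<^sub>F \<epsilon> in at_right 0. norm (real (\<Sum>k=1..first_index_le E \<epsilon>. m k))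
      \<le> (c + 1) powr (1 + a) * norm (1 / \<epsilon> powr (1 + a))"
  proof eventually_elim
    case (elim \<epsilon>)
    define n where "n = nat \<lceil>c / \<epsilon>\<rceil>"
    have ce: "0 < c / \<epsilon>" using c elim by simp
    have n: "n \<ge> 1" "c / \<epsilon> \<le> real n" "real n \<le> c / \<epsilon> + 1"
      using ce by (auto simp: n_def) linarith+
    have "E n \<le> ereal (c / real n)" using E n by blast
    also have "c / real n \<le> \<epsilon>" using n elim by (simp add: field_simps)
    finally have "E n \<le> ereal \<epsilon>" by simp
    then have "first_index_le E \<epsilon> \<le> n" unfolding first_index_le_def using n by (intro cInf_lower) auto
    then have "(\<Sum>k=1..first_index_le E \<epsilon>. m k) \<le> (\<Sum>k=1..n. m k)" by (intro sum_mono2) auto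
    then have "real (\<Sum>k=1..first_index_le E \<epsilon>. m k) \<le> real (\<Sum>k=1..n. m k)" by (rule of_nat_mono)
    also have "\<dots> \<le> (\<Sum>k=1..n. real n powr a)"
      unfolding of_nat_sum
    proof (rule sum_mono)
      fix k assume "k \<in> {1..n}"
      then have k: "1 \<le> k" "k \<le> n" by auto
      have "real (m k) \<le> real k powr a"
        unfolding m[OF k(1)] using k(1) a by (intro nat_floor_powr(3)) auto
      also have "\<dots> \<le> real n powr a" using k a by (intro powr_mono2) auto
      finally show "real (m k) \<le> real n powr a" .
    qed
    also have "\<dots> = real n powr (1 + a)" using n by (simp add: powr_add)
    also have "\<dots> \<le> ((c + 1) / \<epsilon>) powr (1 + a)"
    proof (rule powr_mono2)
      have "1 \<le> 1 / \<epsilon>" using elim by simp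
      then show "real n \<le> (c + 1) / \<epsilon>" using n by (simp add: add_divide_distrib)
    qed (use a in auto)
    also have "\<dots> = (c + 1) powr (1 + a) * (1 / \<epsilon> powr (1 + a))"
      using c elim by (simp add: powr_divide)
    finally show ?case by (simp add: abs_of_nonneg sum_nonneg)
  qed
qed

theorem theorem4p14:
  fixes T :: "'h::{real_inner, banach, second_countable_topology} \<Rightarrow> 'h set"
    and V :: "'h \<Rightarrow> 'h"
    and M :: "'w measure"
    and \<Xi> :: "(real ^ 'd) set"
    and xi0 :: "'w \<Rightarrow> real ^ 'd"
    and Vhat :: "'h \<Rightarrow> real ^ 'd \<Rightarrow> 'h"
    and xi eta :: "nat \<Rightarrow> nat \<Rightarrow> 'w \<Rightarrow> real ^ 'd"
    and x0 x1 xs :: 'h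
    and X Y :: "nat \<Rightarrow> 'w \<Rightarrow> 'h"
    and \<alpha> \<rho> :: "nat \<Rightarrow> real"
    and m :: "nat \<Rightarrow> nat"
    and L D \<sigma> a \<alpha>bar lam :: real
  assumes T: "maximal_monotone_op T"
    and V: "maximal_monotone_op (op_single V)"
    and L: "L > 0" "L-lipschitz_on UNIV V"
    and zeros: "{x. 0 \<in> op_add T (op_single V) x} \<noteq> {}"
    and xs: "xs \<in> op_dom T"
    and D: "D > 0"
    and C_closed: "closed (restricted_set T xs D)"
    and prob: "prob_space M" "complete_measure M"
    and \<Xi>: "\<Xi> \<in> sets borel"
    and xi0: "xi0 \<in> M \<rightarrow>\<^sub>M restrict_space borel \<Xi>"
    and Vhat_measurable:
      "(\<lambda>(x, z). Vhat x z) \<in> borel \<Otimes>\<^sub>M restrict_space borel \<Xi> \<rightarrow>\<^sub>M borel"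
    and unbiased: "\<And>x. has_bochner_integral M (\<lambda>\<omega>. Vhat x (xi0 \<omega>)) (V x)"
    and \<sigma>: "\<sigma> > 0"
    and variance:
      "\<And>x. (\<integral>\<^sup>+\<omega>. ennreal ((norm (Vhat x (xi0 \<omega>) - V x))\<^sup>2) \<partial>M) \<le> ennreal (\<sigma>\<^sup>2)"
    and a: "a > 1"
    and m: "\<And>k. k \<ge> 1 \<Longrightarrow> m k = nat \<lfloor>real k powr a\<rfloor>"
    and lam: "lam \<in> {0<..<1 / (2 * L)}"
    and \<alpha>_mono: "mono_on {1..} \<alpha>"
    and \<alpha>: "\<And>k. k \<ge> 1 \<Longrightarrow> 0 < \<alpha> k \<and> \<alpha> k \<le> \<alpha>bar"
    and \<alpha>bar: "\<alpha>bar < 1"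
    and \<rho>: "\<And>k. k \<ge> 1 \<Longrightarrow>
      \<rho> k = 3 * (1 - \<alpha>bar)\<^sup>2 / (2 * (2 * (\<alpha> k)\<^sup>2 - \<alpha> k + 1) * (1 + L * lam))"
    and draws: "independent_draws M (distr M (restrict_space borel \<Xi>) xi0) m xi eta"
    and init: "x0 \<in> op_dom T" "x1 \<in> op_dom T"
    and process: "risfbf_process (space M) T Vhat \<alpha> \<rho> (\<lambda>_. lam) m xi eta x0 x1 X Y"
  shows "let E = (\<lambda>K. ereal_expectation M
             (\<lambda>\<omega>. gap (op_add T (op_single V)) (restricted_set T xs D) (ergodic_average \<rho> Y K \<omega>)))
         in (\<exists>c::real. \<forall>K\<ge>1. E K \<le> ereal (c / real K)) \<and>
            (\<lambda>\<epsilon>. real (\<Sum>k=1..first_index_le E \<epsilon>. m k)) \<in> O[at_right 0](\<lambda>\<epsilon>. 1 / \<epsilon> powr (1 + a))"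
proof -
  \<comment> \<open>The oracle assumptions are integrals over \<open>M\<close> of functions of
    \<open>xi0\<close>; they are moved to the law \<open>P\<close> by change of variables.\<close>
  define P where "P = distr M (restrict_space borel \<Xi>) xi0"
  interpret prob_space M by (rule prob)
  have sets_P[measurable_cong]: "sets P = sets (restrict_space borel \<Xi>)" by (simp add: P_def)
  have Vhat_x: "Vhat x \<in> borel_measurable (restrict_space borel \<Xi>)" for x
    using measurable_compose[OF measurable_Pair1' Vhat_measurable, of x] by simp
  have mono: "monotone_op T" "monotone_op (op_single V)" using T V by (auto simp: maximal_monotone_op_def)
  have batch: "(\<Sum>k=1..K. 1 / real (m k)) \<le> 2 * (\<Sum>k. real k powr (- a))" for K
    using a m by (rule sum_inverse_batch_bounded)
  have complexity: "(\<lambda>\<epsilon>. real (\<Sum>k=1..first_index_le E \<epsilon>. m k)) \<in> O[at_right 0](\<lambda>\<epsilon>. 1 / \<epsilon> powr (1 + a))"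
    if "c > 0" "\<And>K. K \<ge> 1 \<Longrightarrow> E K \<le> ereal (c / real K)" for c E
    using a m that by (rule oracle_complexity_bigo)
  interpret P: prob_space P unfolding P_def using xi0 by (rule prob_space_distr)
  interpret risfbf M P Vhat V \<sigma> T \<alpha> \<rho> m xi eta x0 x1 xs X Y L lam \<alpha>bar
  proof unfold_locales
    show "(\<lambda>(x, z). Vhat x z) \<in> borel_measurable (borel \<Otimes>\<^sub>M P)"
      using Vhat_measurable by simp
    show "V \<in> borel_measurable borel"
      using L(2) by (intro borel_measurable_continuous_onI lipschitz_on_continuous_on)
    show "has_bochner_integral P (Vhat x) (V x)" for x
      unfolding P_def using Vhat_x xi0 unbiased by (rule has_bochner_integral_distr)
    show "(\<integral>\<^sup>+z. ennreal ((norm (Vhat x z - V x))\<^sup>2) \<partial>P) \<le> ennreal (\<sigma>\<^sup>2)" for x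
      unfolding P_def using variance[of x] Vhat_x[of x] xi0 by (subst nn_integral_distr) auto
    show "2 * L * lam < 1" using lam L by (simp add: field_simps)
    show "1 \<le> m k" if "k \<ge> 1" for k using nat_floor_powr(1)[OF that, of a] a m[OF that] by simp
    show "independent_draws M P m xi eta" using draws by (simp add: P_def)
  qed (use mono L lam \<alpha>_mono \<alpha> \<alpha>bar \<rho> xs process in auto)
  obtain c where c: "c > 0" and bound: "\<And>K. K \<ge> 1 \<Longrightarrow> ereal_expectation M
      (\<lambda>\<omega>. gap (op_add T (op_single V)) (restricted_set T xs D) (ergodic_average \<rho> Y K \<omega>)) \<le> ereal (c / real K)"
    using expected_gap_bound[OF D batch] by blast
  show ?thesis
    unfolding Let_def using complexity[OF c bound] bound by blast
qed

end
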